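(* Let $p$ be a prime and let $\bar{H}=\sum_{H\in\mathcal{H}}\alpha_H\,H$ be a quantum graph whose $p$-constituents $\mathcal{H}=\{H_1,\dots,H_r\}$ are pairwise non-isomorphic order-$p$ reduced graphs, with associated constants $\alpha_H\in\mathbb{Z}_p^*=\{1,\dots,p-1\}$. Then: (1) if there exists $H\in\mathcal{H}$ such that $\#\mathrm{Hom}_p(H)$ is $\#_p\mathrm{P}$-hard, then $\#\mathrm{Hom}_p(\bar{H})$ is $\#_p\mathrm{P}$-hard; (2) if for every $H\in\mathcal{H}$ the problem $\#\mathrm{Hom}_p(H)$ is solvable in polynomial time, then $\#\mathrm{Hom}_p(\bar{H})$ is solvable in polynomial time.
   Context: Graphs are finite and undirected; they may have loops but no multiple edges. A homomorphism from $G$ to $H$ is a map $\sigma:V(G)\to V(H)$ such that $(u,v)\in E(G)$ implies $(\sigma(u),\sigma(v))\in E(H)$; $\hom(G,H)$ denotes the number of such maps. An automorphism $\varrho$ of $H$ has order $k$ if $\varrho$ is not the identity and $k$ is the least positive integer with $\varrho^k=\mathrm{id}$. A graph is order-$p$ reduced if it has no automorphism of order $p$. A quantum graph is a formal finite linear combination $\bar{F}=\sum_{F\in\mathcal{F}}\beta_F F$ of pairwise non-isomorphic graphs with coefficients $\beta_F$ (integers or elements of $\mathbb{Z}_p$); the $p$-constituents are those $F$ with $\beta_F\not\equiv 0\pmod p$. For quantum graphs $\bar{G}=\sum\beta_G G$, $\bar{H}=\sum\alpha_H H$ one sets $\hom(\bar{G},\bar{H})=\sum_G\sum_H\beta_G\alpha_H\hom(G,H)$.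 For a graph $H$, $\#\mathrm{Hom}_p(H)$ is the problem: given a graph $G$, output $\hom(G,H)\bmod p$. For a quantum graph $\bar{H}$, $\#\mathrm{Hom}_p(\bar{H})$ is the problem: given a quantum graph $\bar{G}$, output $\hom(\bar{G},\bar{H})\bmod p$. $\#_p\mathrm{P}$ is the class of functions $f\bmod p$ with $f\in\#\mathrm{P}$; hardness is with respect to polynomial-time Turing reductions. *)

theory Defs
  imports Complex_Main "HOL-Library.FuncSet" "HOL-Library.Poly_Mapping"
    "HOL-Computational_Algebra.Polynomial" "HOL-Computational_Algebra.Primes"
begin

section \<open>Graphs and homomorphisms\<close>

record 'v graph =
  verts :: "'v set"
  edges :: "('v \<times> 'v) set"

text \<open>An undirected edge is represented by both of its orientations; a loop is a pair \<open>(v, v)\<close>.\<close>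

definition is_graph :: "'v graph \<Rightarrow> bool" where
  "is_graph G \<longleftrightarrow> finite (verts G) \<and> edges G \<subseteq> verts G \<times> verts G \<and> sym (edges G)"

text \<open>Homomorphisms are extensional functions, so that each map on the vertices is counted once.\<close>

definition homs :: "'v graph \<Rightarrow> 'w graph \<Rightarrow> ('v \<Rightarrow> 'w) set" where
  "homs G H = {\<sigma> \<in> verts G \<rightarrow>\<^sub>E verts H. \<forall>(u, v) \<in> edges G. (\<sigma> u, \<sigma> v) \<in> edges H}"

definition hom :: "'v graph \<Rightarrow> 'w graph \<Rightarrow> nat" where
  "hom G H = card (homs G H)"

definition graph_iso :: "('v \<Rightarrow> 'w) \<Rightarrow> 'v graph \<Rightarrow> 'w graph \<Rightarrow> bool" where
  "graph_iso \<phi> G H \<longleftrightarrow> bij_betw \<phi> (verts G) (verts H) \<and>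
     (\<forall>u \<in> verts G. \<forall>v \<in> verts G. (u, v) \<in> edges G \<longleftrightarrow> (\<phi> u, \<phi> v) \<in> edges H)"

definition isomorphic :: "'v graph \<Rightarrow> 'w graph \<Rightarrow> bool" where
  "isomorphic G H \<longleftrightarrow> (\<exists>\<phi>. graph_iso \<phi> G H)"

definition automorphism :: "('v \<Rightarrow> 'v) \<Rightarrow> 'v graph \<Rightarrow> bool" where
  "automorphism \<rho> H \<longleftrightarrow> graph_iso \<rho> H H"

text \<open>Automorphisms are compared on the vertex set only; their values elsewhere are irrelevant.\<close>

definition is_id_on :: "'v set \<Rightarrow> ('v \<Rightarrow> 'v) \<Rightarrow> bool" where
  "is_id_on V \<rho> \<longleftrightarrow> (\<forall>v \<in> V. \<rho> v = v)"

definition has_order :: "('v \<Rightarrow> 'v) \<Rightarrow> 'v graph \<Rightarrow> nat \<Rightarrow> bool" where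
  "has_order \<rho> H k \<longleftrightarrow> \<not> is_id_on (verts H) \<rho> \<and>
     0 < k \<and> is_id_on (verts H) (\<rho> ^^ k) \<and>
     (\<forall>j. 0 < j \<and> j < k \<longrightarrow> \<not> is_id_on (verts H) (\<rho> ^^ j))"

definition order_reduced :: "nat \<Rightarrow> 'v graph \<Rightarrow> bool" where
  "order_reduced p H \<longleftrightarrow> \<not> (\<exists>\<rho>. automorphism \<rho> H \<and> has_order \<rho> H p)"


section \<open>Quantum graphs\<close>

text \<open>A formal linear combination is a finitely supported map from graphs to integer coefficients.
  Coefficients in the field of \<open>p\<close> elements are represented by integers.\<close>

definition quantum_graph :: "('v graph \<Rightarrow>\<^sub>0 int) \<Rightarrow> bool" where
  "quantum_graph Q \<longleftrightarrow> (\<forall>F \<in> Poly_Mapping.keys Q. is_graph F) \<and>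
     pairwise (\<lambda>F F'. \<not> isomorphic F F') (Poly_Mapping.keys Q)"

definition p_constituents :: "nat \<Rightarrow> ('v graph \<Rightarrow>\<^sub>0 int) \<Rightarrow> 'v graph set" where
  "p_constituents p Q = {F \<in> Poly_Mapping.keys Q. \<not> int p dvd Poly_Mapping.lookup Q F}"

definition qhom :: "('v graph \<Rightarrow>\<^sub>0 int) \<Rightarrow> ('w graph \<Rightarrow>\<^sub>0 int) \<Rightarrow> int" where
  "qhom A B = (\<Sum>G \<in> Poly_Mapping.keys A. \<Sum>H \<in> Poly_Mapping.keys B.
     Poly_Mapping.lookup A G * Poly_Mapping.lookup B H * int (hom G H))"


section \<open>Computation\<close>

text \<open>Problems are partial functions on bit strings, given by their graphs: a pair \<open>(w, a)\<close> states
  that \<open>w\<close> is a legal instance with answer \<open>a\<close>.\<close>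

type_synonym problem = "(bool list \<times> bool list) set"

text \<open>The machine model is a multi-tape machine with an oracle in structured form. A program acts
  on finitely many stacks of bits, and one basic step pushes, pops or inspects the top of one stack.
  As a Turing machine tape is a pair of stacks and the finite control can be kept on a stack, this
  model and multi-tape Turing machines simulate each other with constant-factor overhead. In
  \<open>Branch r c0 cF cT\<close> the cases are: stack \<open>r\<close> empty, top \<open>False\<close>, top \<open>True\<close>; \<open>While r c\<close> loops as
  long as stack \<open>r\<close> is nonempty; \<open>Ask q r\<close> submits the contents of stack \<open>q\<close> to the oracle and
  replaces the contents of \<open>r\<close> by the answer.\<close>

datatype com =
    Skip
  | Push nat bool
  | Pop nat
  | Seq com com
  | Branch nat com com com
  | While nat com
  | Ask nat nat

type_synonym store = "nat \<Rightarrow> bool list"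

text \<open>\<open>exec B c s t s'\<close>: with an oracle for the problem \<open>B\<close>, program \<open>c\<close> started in \<open>s\<close> halts in
  \<open>s'\<close> after \<open>t\<close> steps. A query outside the domain of \<open>B\<close> blocks the execution, so a halting program
  asks legal instances only. An oracle call is charged for writing down the answer.\<close>

inductive exec :: "problem \<Rightarrow> com \<Rightarrow> store \<Rightarrow> nat \<Rightarrow> store \<Rightarrow> bool" for B :: problem where
  skip: "exec B Skip s 1 s"
| push: "exec B (Push r b) s 1 (s(r := b # s r))"
| pop: "exec B (Pop r) s 1 (s(r := tl (s r)))"
| seq: "exec B c1 s t1 s1 \<Longrightarrow> exec B c2 s1 t2 s2 \<Longrightarrow> exec B (Seq c1 c2) s (t1 + t2) s2"
| branch_empty: "s r = [] \<Longrightarrow> exec B c0 s t s' \<Longrightarrow> exec B (Branch r c0 cF cT) s (Suc t) s'"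
| branch_False: "s r = False # bs \<Longrightarrow> exec B cF s t s' \<Longrightarrow> exec B (Branch r c0 cF cT) s (Suc t) s'"
| branch_True: "s r = True # bs \<Longrightarrow> exec B cT s t s' \<Longrightarrow> exec B (Branch r c0 cF cT) s (Suc t) s'"
| while_end: "s r = [] \<Longrightarrow> exec B (While r c) s 1 s"
| while_step: "s r \<noteq> [] \<Longrightarrow> exec B c s t1 s1 \<Longrightarrow> exec B (While r c) s1 t2 s2 \<Longrightarrow>
    exec B (While r c) s (Suc (t1 + t2)) s2"
| ask: "(s q, a) \<in> B \<Longrightarrow> exec B (Ask q r) s (Suc (length a)) (s(r := a))"

definition start :: "bool list list \<Rightarrow> store" where
  "start ws = (\<lambda>i. if i < length ws then ws ! i else [])"

text \<open>Polynomial-time Turing reducibility of \<open>A\<close> to \<open>B\<close>; input and output are on stack 0.\<close>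

definition poly_turing_reducible :: "problem \<Rightarrow> problem \<Rightarrow> bool" where
  "poly_turing_reducible A B \<longleftrightarrow> (\<exists>c (q :: nat poly). \<forall>(w, a) \<in> A.
     \<exists>t s. exec B c (start [w]) t s \<and> t \<le> poly q (length w) \<and> s 0 = a)"

text \<open>With the empty oracle, where every query blocks, the program runs without oracle.\<close>

definition poly_time_solvable :: "problem \<Rightarrow> bool" where
  "poly_time_solvable A \<longleftrightarrow> poly_turing_reducible A {}"

text \<open>The class #P: functions counting the witnesses \<open>y\<close> of length polynomial in that of \<open>x\<close> which
  are accepted by a polynomial-time verifier.\<close>

definition accepts :: "com \<Rightarrow> bool list \<Rightarrow> bool list \<Rightarrow> bool" where
  "accepts c x y \<longleftrightarrow> (\<exists>t s. exec {} c (start [x, y]) t s \<and> s 0 = [True])"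

definition sharp_P :: "(bool list \<Rightarrow> nat) set" where
  "sharp_P = {f. \<exists>c (q :: nat poly) (l :: nat poly).
     (\<forall>x y. length y = poly l (length x) \<longrightarrow>
        (\<exists>t s. exec {} c (start [x, y]) t s \<and> t \<le> poly q (length x))) \<and>
     (\<forall>x. f x = card {y. length y = poly l (length x) \<and> accepts c x y})}"

text \<open>Residues modulo the fixed number \<open>p\<close> are written in unary; they have bounded length.\<close>

definition enc_residue :: "nat \<Rightarrow> bool list" where
  "enc_residue r = replicate r True"

definition sharp_mod_P :: "nat \<Rightarrow> problem set" where
  "sharp_mod_P p = {{(w, enc_residue (f w mod p)) | w. True} | f. f \<in> sharp_P}"

definition sharp_mod_P_hard :: "nat \<Rightarrow> problem \<Rightarrow> bool" where
  "sharp_mod_P_hard p B \<longleftrightarrow> (\<forall>A \<in> sharp_mod_P p. poly_turing_reducible A B)"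


section \<open>The homomorphism counting problems\<close>

text \<open>Input graphs have vertices \<open>0, \<dots>, n - 1\<close> and are given by \<open>n\<close> in unary followed by the
  adjacency matrix, row by row.\<close>

definition input_graph :: "nat graph \<Rightarrow> bool" where
  "input_graph G \<longleftrightarrow> is_graph G \<and> (\<exists>n. verts G = {..<n})"

definition enc_graph :: "nat graph \<Rightarrow> bool list" where
  "enc_graph G = (let n = card (verts G) in
     replicate n True @ [False] @ map (\<lambda>ij. ij \<in> edges G) (List.product [0..<n] [0..<n]))"

definition Hom_problem :: "nat \<Rightarrow> 'v graph \<Rightarrow> problem" where
  "Hom_problem p H = {(enc_graph G, enc_residue (hom G H mod p)) | G. input_graph G}"

text \<open>Binary representation, most significant bit first.\<close>

fun bits :: "nat \<Rightarrow> bool list" where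
  "bits n = (if n = 0 then [] else bits (n div 2) @ [odd n])"

declare bits.simps [simp del]

text \<open>Integers are given by a sign bit and the binary digits of the absolute value; each digit is
  preceded by \<open>True\<close>, and \<open>False\<close> marks the end.\<close>

definition enc_int :: "int \<Rightarrow> bool list" where
  "enc_int z = (z < 0) # concat (map (\<lambda>b. [True, b]) (bits (nat \<bar>z\<bar>))) @ [False]"

text \<open>A quantum graph is given by its terms, each preceded by \<open>True\<close>, in the order of the list \<open>Gs\<close>
  of its graphs. The constraint that these are pairwise non-isomorphic is a promise on the input.\<close>

definition enc_quantum :: "(nat graph \<Rightarrow>\<^sub>0 int) \<Rightarrow> nat graph list \<Rightarrow> bool list" where
  "enc_quantum Q Gs =
     concat (map (\<lambda>G. True # enc_int (Poly_Mapping.lookup Q G) @ enc_graph G) Gs) @ [False]"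

definition QHom_problem :: "nat \<Rightarrow> ('v graph \<Rightarrow>\<^sub>0 int) \<Rightarrow> problem" where
  "QHom_problem p Hbar =
     {(enc_quantum Gbar Gs, enc_residue (nat (qhom Gbar Hbar mod int p))) | Gbar Gs.
        quantum_graph Gbar \<and> (\<forall>G \<in> Poly_Mapping.keys Gbar. input_graph G) \<and>
        distinct Gs \<and> set Gs = Poly_Mapping.keys Gbar}"

end

theory Submission
  imports Defs "HOL-Number_Theory.Cong" "HOL-Algebra.Sylow" "HOL-Algebra.Multiplicative_Group"
begin

text \<open>For a fixed graph \<open>F\<close>, the disjoint union turns a query \<open>F + G\<close> into
  \<open>hom(F + G, Hbar) = \<Sum>H. \<alpha>(H) hom(F, H) hom(G, H)\<close>. Hence it suffices to find a linear
  combination of graphs \<open>F\<close> for which \<open>H \<mapsto> hom(F, H)\<close> is modulo \<open>p\<close> the indicator of one constituent.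
  As these functions are closed under products, this amounts to separating two constituents. If
  \<open>hom(-, H)\<close> and \<open>hom(-, H')\<close> agreed modulo \<open>p\<close>, then, splitting homomorphisms by their kernels, so
  would the numbers of injective homomorphisms. The number of automorphisms of an order-\<open>p\<close> reduced
  graph is prime to \<open>p\<close> by Cauchy's theorem, so \<open>H\<close> and \<open>H'\<close> would embed into each other.
  The second claim is linearity, and what remains is to carry out both reductions on the stack machine.\<close>

text \<open>The quantum problem accepts only pairwise non-isomorphic graphs, whereas the disjoint
  unions in a linear combination may coincide or be isomorphic. Hence each is submitted as a quantum
  graph of its own with coefficient 1, and the combination modulo \<open>p\<close> is formed from
  the answers. As \<open>p\<close>, the graphs \<open>F\<close> and all coefficients are independent
  of the input, they are written into the program; residues have bounded length, so modular
  arithmetic becomes a finite table. Only the chosen constituent has to be separated from each other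
  constituent \<open>H'\<close>: the functions
  \<open>K \<mapsto> d (hom(F, K) - hom(F, H'))\<close>, one for each \<open>H'\<close>, multiply to
  the indicator as in Lagrange interpolation. Passing to injective maps is what makes the hypothesis
  on automorphisms applicable: an injective endomorphism of a finite graph is an automorphism. For
  the second claim the intermediate problem is the weighted sum of the counts
  \<open>hom(G, H)\<close> for one ordinary graph \<open>G\<close>. Its answers are accumulated
  modulo \<open>p\<close> while the terms of the quantum graph are read.\<close>

hide_const (open) Group.hom

section \<open>Time bounds and programming techniques for the stack machine\<close>

section \<open>Running times\<close>

text \<open>An upper bound in place of the exact time can be weakened, so that branches of different
  cost and calls of merely bounded cost compose.\<close>

definition runs :: "problem \<Rightarrow> com \<Rightarrow> store \<Rightarrow> nat \<Rightarrow> store \<Rightarrow> bool" where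
  "runs B c s T s' \<longleftrightarrow> (\<exists>t \<le> T. exec B c s t s')"

lemma runs_exec: "exec B c s t s' \<Longrightarrow> runs B c s t s'"
  by (auto simp: runs_def)

lemma runs_cong: "runs B c s T s1 \<Longrightarrow> T \<le> T' \<Longrightarrow> s1 = s' \<Longrightarrow> runs B c s T' s'"
  unfolding runs_def using order.trans by blast

lemma runs_cong_start:
  "runs B c s0 T s1 \<Longrightarrow> s0 = s \<Longrightarrow> T \<le> T' \<Longrightarrow> s1 = s' \<Longrightarrow> runs B c s T' s'"
  using runs_cong by blast

lemma runs_skip: "runs B Skip s 1 s"
  by (rule runs_exec, rule exec.skip)

lemma runs_push: "runs B (Push r b) s 1 (s(r := b # s r))"
  by (rule runs_exec, rule exec.push)

lemma runs_pop: "runs B (Pop r) s 1 (s(r := tl (s r)))"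
  by (rule runs_exec, rule exec.pop)

lemma runs_ask: "(s q, a) \<in> B \<Longrightarrow> runs B (Ask q r) s (Suc (length a)) (s(r := a))"
  by (rule runs_exec, rule exec.ask)

lemma runs_seq: "runs B c1 s T1 s1 \<Longrightarrow> runs B c2 s1 T2 s2 \<Longrightarrow> runs B (Seq c1 c2) s (T1 + T2) s2"
  unfolding runs_def using exec.seq add_mono by metis

lemma runs_branch_empty:
  "s r = [] \<Longrightarrow> runs B c0 s T s' \<Longrightarrow> runs B (Branch r c0 cF cT) s (Suc T) s'"
  unfolding runs_def using exec.branch_empty Suc_le_mono by metis

lemma runs_branch_False:
  "s r = False # bs \<Longrightarrow> runs B cF s T s' \<Longrightarrow> runs B (Branch r c0 cF cT) s (Suc T) s'"
  unfolding runs_def using exec.branch_False Suc_le_mono by metis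

lemma runs_branch_True:
  "s r = True # bs \<Longrightarrow> runs B cT s T s' \<Longrightarrow> runs B (Branch r c0 cF cT) s (Suc T) s'"
  unfolding runs_def using exec.branch_True Suc_le_mono by metis

lemma runs_while_step:
  assumes "s r \<noteq> []" "runs B c s T1 s1" "runs B (While r c) s1 T2 s2"
  shows "runs B (While r c) s (Suc (T1 + T2)) s2"
proof -
  obtain t1 t2 where "t1 \<le> T1" "exec B c s t1 s1" "t2 \<le> T2" "exec B (While r c) s1 t2 s2"
    using assms by (auto simp: runs_def)
  then show ?thesis
    using exec.while_step[of s r B c t1 s1 t2 s2] assms(1) unfolding runs_def
    by (intro exI[of _ "Suc (t1 + t2)"]) auto
qed

text \<open>\<open>\<sigma>\<close> lists the stores at the loop test, so a loop is verified by
  giving this sequence in closed form and checking one iteration. The induction is on the number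
  \<open>k\<close> of remaining iterations.\<close>

lemma runs_while:
  assumes "\<And>i. i < n \<Longrightarrow> \<sigma> i r \<noteq> [] \<and> runs B c (\<sigma> i) T (\<sigma> (Suc i))" "\<sigma> n r = []"
  shows "runs B (While r c) (\<sigma> 0) (n * Suc T + 1) (\<sigma> n)"
proof -
  have "k \<le> n \<Longrightarrow> runs B (While r c) (\<sigma> (n - k)) (k * Suc T + 1) (\<sigma> n)" for k
  proof (induction k)
    case 0
    then show ?case using assms(2) by (auto intro!: runs_cong[OF runs_exec[OF exec.while_end]])
  next
    case (Suc k)
    have eq: "Suc (n - Suc k) = n - k" using Suc.prems by auto
    have "runs B (While r c) (\<sigma> (n - Suc k)) (Suc (T + (k * Suc T + 1))) (\<sigma> n)"
      using assms(1)[of "n - Suc k"] Suc by (intro runs_while_step[of _ _ _ _ _ "\<sigma> (n - k)"]) (auto simp: eq)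
    then show ?case by (simp add: algebra_simps)
  qed
  from this[of n] show ?thesis by simp
qed

section \<open>Polynomial bounds\<close>

text \<open>Closed under the operations that build the time bounds, so that these need not be
  brought into the form of an explicit polynomial.\<close>

definition poly_bounded :: "(nat \<Rightarrow> nat) \<Rightarrow> bool" where
  "poly_bounded f \<longleftrightarrow> (\<exists>q :: nat poly. \<forall>n. f n \<le> poly q n)"

lemma poly_nat_mono: "m \<le> n \<Longrightarrow> poly q m \<le> poly q n" for q :: "nat poly"
  by (induction q) (auto intro: add_mono mult_mono)

lemma poly_bounded_const: "poly_bounded (\<lambda>_. c)"
  unfolding poly_bounded_def by (rule exI[of _ "[:c:]"]) simp

lemma poly_bounded_id: "poly_bounded (\<lambda>n. n)"
  unfolding poly_bounded_def by (rule exI[of _ "[:0, 1:]"]) simp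

lemma poly_bounded_add: "poly_bounded f \<Longrightarrow> poly_bounded g \<Longrightarrow> poly_bounded (\<lambda>n. f n + g n)"
  unfolding poly_bounded_def by (metis add_mono poly_add)

lemma poly_bounded_mult: "poly_bounded f \<Longrightarrow> poly_bounded g \<Longrightarrow> poly_bounded (\<lambda>n. f n * g n)"
  unfolding poly_bounded_def by (metis mult_le_mono poly_mult)

lemma poly_bounded_Suc: "poly_bounded f \<Longrightarrow> poly_bounded (\<lambda>n. Suc (f n))"
  using poly_bounded_add[OF _ poly_bounded_const[of 1]] by simp

text \<open>A polynomial with natural coefficients is monotone, so \<open>f\<close> may be replaced
  inside it by its own polynomial bound.\<close>

lemma poly_bounded_compose:
  assumes "poly_bounded f"
  shows "poly_bounded (\<lambda>n. poly q (f n))"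
proof -
  obtain q' where "\<forall>n. f n \<le> poly q' n" using assms by (auto simp: poly_bounded_def)
  then have "poly q (f n) \<le> poly (pcompose q q') n" for n
    by (simp add: poly_pcompose poly_nat_mono)
  then show ?thesis unfolding poly_bounded_def by blast
qed

lemmas poly_bounded_intros = poly_bounded_const poly_bounded_id poly_bounded_add poly_bounded_mult
  poly_bounded_Suc poly_bounded_compose

lemma poly_turing_reducible_runsI:
  assumes "poly_bounded T"
    and "\<And>w a. (w, a) \<in> P \<Longrightarrow> \<exists>s. runs B c (start [w]) (T (length w)) s \<and> s 0 = a"
  shows "poly_turing_reducible P B"
proof -
  obtain q where q: "\<forall>n. T n \<le> poly q n" using assms(1) by (auto simp: poly_bounded_def)
  show ?thesis unfolding poly_turing_reducible_def
  proof (intro exI[of _ c] exI[of _ q] ballI, clarify)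
    fix w a assume "(w, a) \<in> P"
    then obtain t s where "exec B c (start [w]) t s" "t \<le> T (length w)" "s 0 = a"
      using assms(2) by (force simp: runs_def)
    with q show "\<exists>t s. exec B c (start [w]) t s \<and> t \<le> poly q (length w) \<and> s 0 = a"
      using order.trans by blast
  qed
qed

lemma poly_turing_reducible_runsE:
  assumes "poly_turing_reducible P B"
  obtains c q where "\<forall>w a. (w, a) \<in> P \<longrightarrow> (\<exists>s. runs B c (start [w]) (poly q (length w)) s \<and> s 0 = a)"
proof -
  obtain c q where "\<forall>(w, a) \<in> P. \<exists>t s. exec B c (start [w]) t s \<and> t \<le> poly q (length w) \<and> s 0 = a"
    using assms unfolding poly_turing_reducible_def by blast
  then show ?thesis by (intro that[of c q]) (fastforce simp: runs_def)
qed

section \<open>Straight-line building blocks\<close>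

definition pushes :: "nat \<Rightarrow> bool list \<Rightarrow> com" where
  "pushes r xs = foldr (\<lambda>b. Seq (Push r b)) xs Skip"

lemma runs_pushes: "runs B (pushes r xs) s (length xs + 1) (s(r := rev xs @ s r))"
proof (induction xs arbitrary: s)
  case Nil
  then show ?case using runs_skip by (simp add: pushes_def)
next
  case (Cons b xs)
  show ?case
    unfolding pushes_def foldr.simps comp_def
    by (rule runs_cong[OF runs_seq[OF runs_push Cons.IH[unfolded pushes_def]]]) auto
qed

definition clear :: "nat \<Rightarrow> com" where
  "clear r = While r (Pop r)"

lemma runs_clear: "runs B (clear r) s (2 * length (s r) + 1) (s(r := []))"
proof -
  let ?\<sigma> = "\<lambda>i. s(r := drop i (s r))"
  have "runs B (clear r) (?\<sigma> 0) (length (s r) * Suc 1 + 1) (?\<sigma> (length (s r)))"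
    unfolding clear_def
  proof (rule runs_while)
    fix i assume "i < length (s r)"
    then show "?\<sigma> i r \<noteq> [] \<and> runs B (Pop r) (?\<sigma> i) 1 (?\<sigma> (Suc i))"
      using runs_pop[of B r "?\<sigma> i"] by (simp add: drop_Suc tl_drop)
  qed simp
  then show ?thesis by (rule runs_cong_start) auto
qed

definition move1 :: "nat \<Rightarrow> nat \<Rightarrow> com" where
  "move1 a b = Branch a Skip (Seq (Pop a) (Push b False)) (Seq (Pop a) (Push b True))"

lemma runs_move1:
  assumes "a \<noteq> b" "s a = x # xs"
  shows "runs B (move1 a b) s 3 (s(a := xs, b := x # s b))"
proof (cases x)
  case True
  with assms show ?thesis unfolding move1_def
    by (intro runs_cong[OF runs_branch_True[OF _ runs_seq[OF runs_pop runs_push]]]) auto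
next
  case False
  with assms show ?thesis unfolding move1_def
    by (intro runs_cong[OF runs_branch_False[OF _ runs_seq[OF runs_pop runs_push]]]) auto
qed

definition drain :: "nat \<Rightarrow> nat \<Rightarrow> com" where
  "drain a b = While a (move1 a b)"

lemma runs_drain:
  assumes "a \<noteq> b"
  shows "runs B (drain a b) s (4 * length (s a) + 1) (s(a := [], b := rev (s a) @ s b))"
proof -
  let ?\<sigma> = "\<lambda>i. s(a := drop i (s a), b := rev (take i (s a)) @ s b)"
  have "runs B (drain a b) (?\<sigma> 0) (length (s a) * Suc 3 + 1) (?\<sigma> (length (s a)))"
    unfolding drain_def
  proof (rule runs_while)
    fix i assume i: "i < length (s a)"
    have "runs B (move1 a b) (?\<sigma> i) 3 (?\<sigma> (Suc i))"
      using i assms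
      by (intro runs_cong[OF runs_move1[of a b "?\<sigma> i" "s a ! i" "drop (Suc i) (s a)"]])
        (auto simp: Cons_nth_drop_Suc take_Suc_conv_app_nth fun_eq_iff)
    then show "?\<sigma> i a \<noteq> [] \<and> runs B (move1 a b) (?\<sigma> i) 3 (?\<sigma> (Suc i))"
      using i assms by simp
  qed (use assms in simp)
  then show ?thesis by (rule runs_cong_start) auto
qed

definition move2 :: "nat \<Rightarrow> nat \<Rightarrow> nat \<Rightarrow> com" where
  "move2 a b c = Branch a Skip (Seq (Pop a) (Seq (Push b False) (Push c False)))
     (Seq (Pop a) (Seq (Push b True) (Push c True)))"

lemma runs_move2:
  assumes "distinct [a, b, c]" "s a = x # xs"
  shows "runs B (move2 a b c) s 4 (s(a := xs, b := x # s b, c := x # s c))"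
proof (cases x)
  case True
  with assms show ?thesis unfolding move2_def
    by (intro runs_cong[OF runs_branch_True[OF _ runs_seq[OF runs_pop runs_seq[OF runs_push runs_push]]]])
      (auto simp: fun_eq_iff)
next
  case False
  with assms show ?thesis unfolding move2_def
    by (intro runs_cong[OF runs_branch_False[OF _ runs_seq[OF runs_pop runs_seq[OF runs_push runs_push]]]])
      (auto simp: fun_eq_iff)
qed

text \<open>Draining \<open>a\<close> onto \<open>t\<close> reverses the word; moving it back onto
  both \<open>a\<close> and \<open>b\<close> reverses it again.\<close>

definition copy :: "nat \<Rightarrow> nat \<Rightarrow> nat \<Rightarrow> com" where
  "copy a b t = Seq (drain a t) (While t (move2 t a b))"

lemma runs_copy:
  assumes d: "distinct [a, b, t]" and e: "s b = []" "s t = []"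
  shows "runs B (copy a b t) s (9 * length (s a) + 2) (s(b := s a))"
proof -
  let ?w = "rev (s a)"
  let ?\<sigma> = "\<lambda>i. s(t := drop i ?w, a := rev (take i ?w), b := rev (take i ?w))"
  have "runs B (While t (move2 t a b)) (?\<sigma> 0) (length ?w * Suc 4 + 1) (?\<sigma> (length ?w))"
  proof (rule runs_while)
    fix i assume i: "i < length ?w"
    have "runs B (move2 t a b) (?\<sigma> i) 4 (?\<sigma> (Suc i))"
      using i d
      by (intro runs_cong[OF runs_move2[of t a b "?\<sigma> i" "?w ! i" "drop (Suc i) ?w"]])
        (auto simp: Cons_nth_drop_Suc take_Suc_conv_app_nth fun_eq_iff)
    then show "?\<sigma> i t \<noteq> [] \<and> runs B (move2 t a b) (?\<sigma> i) 4 (?\<sigma> (Suc i))"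
      using i d by simp
  qed (use d in simp)
  moreover have "runs B (drain a t) s (4 * length (s a) + 1) (?\<sigma> 0)"
    by (rule runs_cong[OF runs_drain]) (use d e in \<open>auto simp: fun_eq_iff\<close>)
  ultimately have "runs B (copy a b t) s (4 * length (s a) + 1 + (length ?w * Suc 4 + 1)) (?\<sigma> (length ?w))"
    unfolding copy_def by (intro runs_seq)
  then show ?thesis by (rule runs_cong) (use d e in \<open>auto simp: fun_eq_iff\<close>)
qed

section \<open>Subroutines\<close>

primrec width :: "com \<Rightarrow> nat" where
  "width Skip = 0"
| "width (Push r b) = Suc r"
| "width (Pop r) = Suc r"
| "width (Seq c1 c2) = max (width c1) (width c2)"
| "width (Branch r c0 cF cT) = max (Suc r) (max (width c0) (max (width cF) (width cT)))"
| "width (While r c) = max (Suc r) (width c)"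
| "width (Ask q r) = max (Suc q) (Suc r)"

text \<open>Only finitely many registers can be left dirty, and \<open>width\<close> bounds them;
  this makes it possible to clean up after a call.\<close>

lemma exec_outside_width: "exec B c s t s' \<Longrightarrow> width c \<le> i \<Longrightarrow> s' i = s i"
  by (induction rule: exec.induct) auto

text \<open>A push adds a single bit, and an oracle answer, which may be longer, is charged for its
  length.\<close>

lemma exec_length: "exec B c s t s' \<Longrightarrow> length (s' i) \<le> length (s i) + t"
  by (induction rule: exec.induct) auto

primrec shift :: "nat \<Rightarrow> com \<Rightarrow> com" where
  "shift k Skip = Skip"
| "shift k (Push r b) = Push (k + r) b"
| "shift k (Pop r) = Pop (k + r)"
| "shift k (Seq c1 c2) = Seq (shift k c1) (shift k c2)"
| "shift k (Branch r c0 cF cT) = Branch (k + r) (shift k c0) (shift k cF) (shift k cT)"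
| "shift k (While r c) = While (k + r) (shift k c)"
| "shift k (Ask q r) = Ask (k + q) (k + r)"

definition above :: "nat \<Rightarrow> store \<Rightarrow> store \<Rightarrow> store" where
  "above k u s = (\<lambda>i. if i < k then u i else s (i - k))"

lemma above_apply [simp]: "above k u s (k + r) = s r"
  by (simp add: above_def)

lemma above_upd: "above k u (s(r := x)) = (above k u s)(k + r := x)"
  by (auto simp: above_def fun_eq_iff)

text \<open>The registers below \<open>k\<close>, given by \<open>u\<close>, form a frame: they
  belong to the caller and stay as they are.\<close>

lemma exec_shift: "exec B c s t s' \<Longrightarrow> exec B (shift k c) (above k u s) t (above k u s')"
proof (induction rule: exec.induct)
  case (branch_empty s r c0 t s' cF cT)
  then show ?case by (auto intro: exec.branch_empty)
next
  case (branch_False s r bs cF t s' c0 cT)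
  then show ?case by (auto intro: exec.branch_False)
next
  case (branch_True s r bs cT t s' c0 cF)
  then show ?case by (auto intro: exec.branch_True)
next
  case (push r b s)
  show ?case using exec.push[of B "k + r" b "above k u s"] unfolding above_upd above_apply shift.simps .
next
  case (pop r s)
  show ?case using exec.pop[of B "k + r" "above k u s"] unfolding above_upd above_apply shift.simps .
next
  case (while_step s r c t1 s1 t2 s2)
  then show ?case using exec.while_step[of "above k u s" "k + r" B "shift k c"] by simp
next
  case (ask s q a r)
  then show ?case using exec.ask[of "above k u s" "k + q" a B "k + r"]
    unfolding above_upd above_apply shift.simps by blast
qed (auto intro: exec.intros simp: exec.skip[simplified] exec.while_end[simplified])

primrec clear_range :: "nat \<Rightarrow> nat \<Rightarrow> com" where
  "clear_range k 0 = Skip"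
| "clear_range k (Suc n) = Seq (clear_range k n) (clear (k + n))"

lemma runs_clear_range:
  assumes "\<And>i. k \<le> i \<Longrightarrow> length (s i) \<le> L"
  shows "runs B (clear_range k n) s (n * (2 * L + 1) + 1) (\<lambda>i. if k \<le> i \<and> i < k + n then [] else s i)"
proof (induction n)
  case 0
  show ?case unfolding clear_range.simps by (rule runs_cong[OF runs_skip]) (auto simp: fun_eq_iff)
next
  case (Suc n)
  show ?case unfolding clear_range.simps
    by (rule runs_cong[OF runs_seq[OF Suc.IH runs_clear]])
      (use assms[of "k + n"] in \<open>auto simp: fun_eq_iff algebra_simps\<close>)
qed

text \<open>The called program runs on the registers from \<open>k\<close> on, which are empty before and after.\<close>

definition subroutine :: "com \<Rightarrow> nat \<Rightarrow> nat \<Rightarrow> nat \<Rightarrow> com" where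
  "subroutine c k q r = Seq (copy q k (Suc k)) (Seq (shift k c) (Seq (clear_range (Suc k) (width c))
     (Seq (clear r) (Seq (drain k (Suc k)) (drain (Suc k) r)))))"

text \<open>No stack of the called program exceeds \<open>length w + T\<close>, and clearing
  \<open>width c\<close> registers suffices. The answer is drained twice, which restores its order;
  the old contents of \<open>r\<close> are erased before that, hence \<open>length (s r)\<close> in
  the bound.\<close>

lemma runs_subroutine:
  assumes run: "runs B c (start [w]) T s'" "s' 0 = a"
    and q: "q < k" "s q = w" and r: "r < k" and e: "\<And>i. k \<le> i \<Longrightarrow> s i = []"
  shows "runs B (subroutine c k q r) s ((20 + 2 * width c) * (length w + length (s r) + T + 1)) (s(r := a))"
proof -
  let ?n = "length w + T"
  obtain t where t: "t \<le> T" "exec B c (start [w]) t s'" using run by (auto simp: runs_def)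
  let ?u = "above k s s'"
  have len: "length (s' i) \<le> ?n" for i
    using exec_length[OF t(2), of i] t(1) by (auto simp: start_def split: if_splits)
  have 1: "runs B (copy q k (Suc k)) s (9 * length w + 2) (above k s (start [w]))"
    using q e by (intro runs_cong[OF runs_copy]) (auto simp: above_def start_def fun_eq_iff)
  have 2: "runs B (shift k c) (above k s (start [w])) T ?u"
    using exec_shift[OF t(2)] t(1) by (auto simp: runs_def)
  let ?v = "\<lambda>i. if Suc k \<le> i \<and> i < Suc k + width c then [] else ?u i"
  have 3: "runs B (clear_range (Suc k) (width c)) ?u (width c * (2 * ?n + 1) + 1) ?v"
    using len by (intro runs_clear_range) (auto simp: above_def)
  \<comment> \<open>Registers that the program cannot touch keep their initial contents, which are
    empty except for the input in register 0.\<close>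
  have out: "s' i = []" if "width c \<le> i" "0 < i" for i
    using exec_outside_width[OF t(2) that(1)] that by (simp add: start_def)
  have v: "?v = s(k := a)"
    using run(2) out[of "i - k" for i] e by (auto simp: above_def fun_eq_iff)
  have 4: "runs B (clear r) (s(k := a)) (2 * length (s r) + 1) (s(k := a, r := []))"
    using r by (intro runs_cong[OF runs_clear]) auto
  have la: "length a \<le> ?n" using len[of 0] run(2) by simp
  have 5: "runs B (drain k (Suc k)) (s(k := a, r := [])) (4 * ?n + 1) (s(Suc k := rev a, r := []))"
    using r e la by (intro runs_cong[OF runs_drain]) (auto simp: fun_eq_iff)
  have 6: "runs B (drain (Suc k) r) (s(Suc k := rev a, r := [])) (4 * ?n + 1) (s(r := a))"
    using r e la by (intro runs_cong[OF runs_drain]) (auto simp: fun_eq_iff)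
  show ?thesis unfolding subroutine_def
    by (rule runs_cong[OF runs_seq[OF 1 runs_seq[OF 2 runs_seq[OF 3[unfolded v] runs_seq[OF 4 runs_seq[OF 5 6]]]]]])
      (auto simp: algebra_simps)
qed

primrec inline :: "(nat \<Rightarrow> nat \<Rightarrow> com) \<Rightarrow> com \<Rightarrow> com" where
  "inline d Skip = Skip"
| "inline d (Push r b) = Push r b"
| "inline d (Pop r) = Pop r"
| "inline d (Seq c1 c2) = Seq (inline d c1) (inline d c2)"
| "inline d (Branch r c0 cF cT) = Branch r (inline d c0) (inline d cF) (inline d cT)"
| "inline d (While r c) = While r (inline d c)"
| "inline d (Ask q r) = d q r"

text \<open>Each step is charged with a full emulation of a query. The assumption
  \<open>length (s i) + t \<le> M\<close> treats the remaining time as a budget: a step lengthens a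
  stack by at most its cost, so the assumption passes to every part of the execution and bounds both
  registers at every query.\<close>

lemma runs_inline:
  assumes d: "\<And>s q r a. q < k \<Longrightarrow> r < k \<Longrightarrow> (s q, a) \<in> B \<Longrightarrow> \<forall>i \<ge> k. s i = [] \<Longrightarrow>
      length (s q) \<le> M \<Longrightarrow> length (s r) \<le> M \<Longrightarrow> runs C (d q r) s T (s(r := a))"
  shows "exec B c s t s' \<Longrightarrow> width c \<le> k \<Longrightarrow> \<forall>i \<ge> k. s i = [] \<Longrightarrow> \<forall>i. length (s i) + t \<le> M \<Longrightarrow>
    runs C (inline d c) s (t * Suc T) s'"
proof (induction rule: exec.induct)
  case (seq c1 s t1 s1 c2 t2 s2)
  have "\<forall>i \<ge> k. s1 i = []" using exec_outside_width[OF seq.hyps(1)] seq.prems by auto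
  moreover have "length (s1 i) + t2 \<le> M" for i
    using exec_length[OF seq.hyps(1), of i] seq.prems(3)[rule_format, of i] by simp
  moreover have "length (s i) + t1 \<le> M" for i using seq.prems(3)[rule_format, of i] by simp
  ultimately show ?case using seq.IH seq.prems
    by (auto intro!: runs_cong[OF runs_seq] simp: algebra_simps)
next
  case (while_step s r c t1 s1 t2 s2)
  have "\<forall>i \<ge> k. s1 i = []" using exec_outside_width[OF while_step.hyps(2)] while_step.prems by auto
  moreover have "length (s1 i) + t2 \<le> M" for i
    using exec_length[OF while_step.hyps(2), of i] while_step.prems(3)[rule_format, of i] by simp
  moreover have "length (s i) + t1 \<le> M" for i using while_step.prems(3)[rule_format, of i] by simp
  ultimately have "runs C (inline d c) s (t1 * Suc T) s1"
    "runs C (inline d (While r c)) s1 (t2 * Suc T) s2"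
    using while_step.IH while_step.prems by auto
  from runs_while_step[OF while_step.hyps(1) this(1) this(2)[unfolded inline.simps]] show ?case
    by (auto elim!: runs_cong simp: algebra_simps)
next
  case (branch_empty s r c0 t s' cF cT)
  then have "runs C (inline d c0) s (t * Suc T) s'" by (auto simp: Suc_le_eq less_imp_le)
  with branch_empty.hyps show ?case by (auto intro!: runs_cong[OF runs_branch_empty])
next
  case (branch_False s r bs cF t s' c0 cT)
  then have "runs C (inline d cF) s (t * Suc T) s'" by (auto simp: Suc_le_eq less_imp_le)
  with branch_False.hyps show ?case by (auto intro!: runs_cong[OF runs_branch_False])
next
  case (branch_True s r bs cT t s' c0 cF)
  then have "runs C (inline d cT) s (t * Suc T) s'" by (auto simp: Suc_le_eq less_imp_le)
  with branch_True.hyps show ?case by (auto intro!: runs_cong[OF runs_branch_True])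
next
  case (ask s q a r)
  have "length (s i) \<le> M" for i using ask.prems(3)[rule_format, of i] by simp
  with ask have "runs C (d q r) s T (s(r := a))" by (intro d) auto
  then show ?case unfolding inline.simps by (rule runs_cong) auto
qed (auto intro!: runs_cong[OF runs_skip] runs_cong[OF runs_push] runs_cong[OF runs_pop]
     runs_cong[OF runs_exec[OF exec.while_end]])

lemma poly_turing_reducible_trans:
  assumes "poly_turing_reducible P B" "poly_turing_reducible B C"
  shows "poly_turing_reducible P C"
proof -
  obtain c p where c: "\<forall>w a. (w, a) \<in> P \<longrightarrow> (\<exists>s. runs B c (start [w]) (poly p (length w)) s \<and> s 0 = a)"
    using poly_turing_reducible_runsE[OF assms(1)] by blast
  obtain c' p' where c': "\<forall>w a. (w, a) \<in> B \<longrightarrow> (\<exists>s. runs C c' (start [w]) (poly p' (length w)) s \<and> s 0 = a)"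
    using poly_turing_reducible_runsE[OF assms(2)] by blast
  \<comment> \<open>The successor keeps register 0, which holds the input, below \<open>?k\<close>
    even if \<open>c\<close> uses no register at all.\<close>
  let ?k = "Suc (width c)"
  let ?d = "subroutine c' ?k"
  let ?M = "\<lambda>n. n + poly p n"
  let ?T = "\<lambda>m. (20 + 2 * width c') * (m + m + poly p' m + 1)"
  show ?thesis
  proof (rule poly_turing_reducible_runsI)
    show "poly_bounded (\<lambda>n. poly p n * Suc (?T (?M n)))"
      by (intro poly_bounded_intros)
    fix w a assume "(w, a) \<in> P"
    then obtain s t where s: "exec B c (start [w]) t s" "t \<le> poly p (length w)" "s 0 = a"
      using c by (force simp: runs_def)
    let ?m = "?M (length w)"
    have "runs C (inline ?d c) (start [w]) (t * Suc (?T ?m)) s"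
    proof (rule runs_inline[OF _ s(1)])
      fix s :: store and q r a
      assume q: "q < ?k" "r < ?k" "(s q, a) \<in> B" "\<forall>i \<ge> ?k. s i = []"
        "length (s q) \<le> ?m" "length (s r) \<le> ?m"
      from c' q(3) obtain s' where s': "runs C c' (start [s q]) (poly p' (length (s q))) s'" "s' 0 = a"
        by blast
      have "length (s q) + length (s r) + poly p' (length (s q)) + 1 \<le> ?m + ?m + poly p' ?m + 1"
        using q(5,6) by (intro add_mono poly_nat_mono) auto
      then show "runs C (?d q r) s (?T ?m) (s(r := a))"
        using q by (intro runs_cong[OF runs_subroutine[OF s']] mult_le_mono2) auto
    qed (use s in \<open>auto simp: start_def\<close>)
    then have "runs C (inline ?d c) (start [w]) (poly p (length w) * Suc (?T ?m)) s"
      by (rule runs_cong) (use s(2) in \<open>auto intro: mult_le_mono1\<close>)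
    with s(3) show "\<exists>s. runs C (inline ?d c) (start [w]) (poly p (length w) * Suc (?T ?m)) s \<and> s 0 = a"
      by blast
  qed
qed

section \<open>Loops\<close>

text \<open>A residue has one of finitely many values, so nested case distinctions tabulate a
  function of several residues in the program text. This replaces all modular arithmetic.\<close>

primrec case_unary :: "nat \<Rightarrow> nat \<Rightarrow> (nat \<Rightarrow> com) \<Rightarrow> com" where
  "case_unary r 0 C = C 0"
| "case_unary r (Suc L) C = Branch r (C 0) Skip (Seq (Pop r) (case_unary r L (\<lambda>k. C (Suc k))))"

lemma runs_case_unary:
  assumes "s r = replicate k True" "k \<le> L" "runs B (C k) (s(r := [])) T s'"
  shows "runs B (case_unary r L C) s (T + 2 * L) s'"
  using assms
proof (induction L arbitrary: s k C)
  case 0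
  then have "s(r := []) = s" by auto
  with 0 show ?case by simp
next
  case (Suc L)
  show ?case
  proof (cases k)
    case 0
    with Suc.prems have "s(r := []) = s" by auto
    with 0 Suc.prems show ?thesis
      unfolding case_unary.simps by (intro runs_cong[OF runs_branch_empty]) auto
  next
    case (Suc k')
    have "runs B (case_unary r L (\<lambda>k. C (Suc k))) (s(r := tl (s r))) (T + 2 * L) s'"
      using Suc Suc.prems by (intro Suc.IH[of _ k']) (auto simp del: fun_upd_apply simp: fun_upd_same)
    with Suc Suc.prems show ?thesis
      unfolding case_unary.simps
      by (intro runs_cong[OF runs_branch_True[OF _ runs_seq[OF runs_pop]]]) auto
  qed
qed

text \<open>This loop is unrolled when the program is built, over a list independent of the input;
  \<open>repeat\<close> is its counterpart for a count known only at run time.\<close>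

primrec for_each :: "('a \<Rightarrow> com) \<Rightarrow> 'a list \<Rightarrow> com" where
  "for_each f [] = Skip"
| "for_each f (x # xs) = Seq (f x) (for_each f xs)"

lemma runs_for_each:
  "(\<And>i. i < length xs \<Longrightarrow> runs B (f (xs ! i)) (\<sigma> i) T (\<sigma> (Suc i))) \<Longrightarrow>
    runs B (for_each f xs) (\<sigma> 0) (length xs * T + 1) (\<sigma> (length xs))"
proof (induction xs arbitrary: \<sigma>)
  case Nil
  then show ?case using runs_skip by simp
next
  case (Cons x xs)
  have "runs B (f x) (\<sigma> 0) T (\<sigma> 1)" using Cons.prems[of 0] by simp
  moreover have "runs B (for_each f xs) (\<sigma> (Suc 0)) (length xs * T + 1) (\<sigma> (Suc (length xs)))"
    using Cons.prems[of "Suc i" for i] by (intro Cons.IH[of "\<lambda>i. \<sigma> (Suc i)"]) auto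
  ultimately show ?case by (auto intro!: runs_cong[OF runs_seq])
qed

text \<open>The iteration count is moved from \<open>a\<close> to \<open>b\<close> and restored at the end.\<close>

definition repeat :: "nat \<Rightarrow> nat \<Rightarrow> com \<Rightarrow> com" where
  "repeat a b c = Seq (While a (Seq (Pop a) (Seq (Push b True) c))) (drain b a)"

text \<open>The two counter registers change during the loop, while \<open>\<sigma>\<close> shows
  them in their outer state. The body is therefore required to work for arbitrary contents
  \<open>x\<close> and \<open>y\<close> of these registers and to preserve them.\<close>

lemma runs_repeat:
  assumes ab: "a \<noteq> b" and \<sigma>: "\<And>i. i \<le> n \<Longrightarrow> \<sigma> i a = replicate n True \<and> \<sigma> i b = []"
    and c: "\<And>i x y. i < n \<Longrightarrow> runs B c ((\<sigma> i)(a := x, b := y)) T ((\<sigma> (Suc i))(a := x, b := y))"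
  shows "runs B (repeat a b c) (\<sigma> 0) (n * (T + 7) + 2) (\<sigma> n)"
proof -
  let ?\<tau> = "\<lambda>i. (\<sigma> i)(a := replicate (n - i) True, b := replicate i True)"
  have "runs B (While a (Seq (Pop a) (Seq (Push b True) c))) (?\<tau> 0) (n * Suc (1 + (1 + T)) + 1) (?\<tau> n)"
  proof (rule runs_while)
    fix i assume i: "i < n"
    have 1: "runs B (Seq (Push b True) c) ((\<sigma> i)(a := replicate (n - Suc i) True, b := replicate i True))
       (1 + T) (?\<tau> (Suc i))"
      using c[OF i] by (intro runs_seq[OF runs_cong[OF runs_push order_refl refl]]) simp
    have 2: "runs B (Pop a) (?\<tau> i) 1 ((\<sigma> i)(a := replicate (n - Suc i) True, b := replicate i True))"
      by (rule runs_cong[OF runs_pop]) (use ab i in \<open>auto simp: fun_eq_iff\<close>)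
    show "?\<tau> i a \<noteq> [] \<and> runs B (Seq (Pop a) (Seq (Push b True) c)) (?\<tau> i) (1 + (1 + T)) (?\<tau> (Suc i))"
      using ab i runs_seq[OF 2 1] by simp
  qed (use ab in simp)
  moreover have "?\<tau> 0 = \<sigma> 0" using \<sigma>[of 0] by (auto simp: fun_eq_iff)
  moreover have "runs B (drain b a) (?\<tau> n) (4 * n + 1) (\<sigma> n)"
    by (rule runs_cong[OF runs_drain]) (use ab \<sigma>[of n] in \<open>auto simp: fun_eq_iff\<close>)
  ultimately have "runs B (repeat a b c) (\<sigma> 0) (n * Suc (1 + (1 + T)) + 1 + (4 * n + 1)) (\<sigma> n)"
    unfolding repeat_def by (intro runs_seq) auto
  then show ?thesis by (rule runs_cong) (auto simp: algebra_simps)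
qed

text \<open>The loop has to stop at the terminating \<open>False\<close> rather than at the end of
  the stack, but \<open>While\<close> tests only for emptiness; the flag \<open>f\<close> translates
  one into the other.\<close>

definition parse_unary :: "nat \<Rightarrow> nat \<Rightarrow> nat \<Rightarrow> com" where
  "parse_unary a f b = Seq (Push f True)
     (While f (Branch a Skip (Seq (Pop a) (Pop f)) (Seq (Pop a) (Push b True))))"

lemma runs_parse_unary:
  assumes d: "distinct [a, f, b]" and s: "s a = replicate n True @ False # xs" "s f = []"
  shows "runs B (parse_unary a f b) s (4 * n + 6) (s(a := xs, b := replicate n True @ s b))"
proof -
  \<comment> \<open>The terminator takes an iteration of its own after the \<open>n\<close> marks;
    the last case is the store after it, with the flag removed.\<close>
  let ?\<sigma> = "\<lambda>i. if i \<le> n then s(f := [True], a := replicate (n - i) True @ False # xs, b := replicate i True @ s b)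
     else s(a := xs, b := replicate n True @ s b)"
  let ?c = "Branch a Skip (Seq (Pop a) (Pop f)) (Seq (Pop a) (Push b True))"
  have "runs B (While f ?c) (?\<sigma> 0) (Suc n * Suc 3 + 1) (?\<sigma> (Suc n))"
  proof (rule runs_while)
    fix i assume i: "i < Suc n"
    have "runs B ?c (?\<sigma> i) 3 (?\<sigma> (Suc i))"
    proof (cases "i = n")
      case True
      with d s show ?thesis
        by (intro runs_cong[OF runs_branch_False[OF _ runs_seq[OF runs_pop runs_pop]]])
          (auto simp: fun_eq_iff)
    next
      case False
      with i obtain k where k: "n - i = Suc k" "n - Suc i = k" by (metis Suc_diff_Suc le_neq_implies_less less_Suc_eq_le)
      with False i d s show ?thesis
        by (intro runs_cong[OF runs_branch_True[OF _ runs_seq[OF runs_pop runs_push]]])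
          (auto simp: fun_eq_iff replicate_app_Cons_same)
    qed
    then show "?\<sigma> i f \<noteq> [] \<and> runs B ?c (?\<sigma> i) 3 (?\<sigma> (Suc i))" using i d by auto
  qed (use d s in auto)
  moreover have "runs B (Push f True) s 1 (?\<sigma> 0)"
    by (rule runs_cong[OF runs_push]) (use d s in \<open>auto simp: fun_eq_iff\<close>)
  ultimately have "runs B (parse_unary a f b) s (1 + (Suc n * Suc 3 + 1)) (?\<sigma> (Suc n))"
    unfolding parse_unary_def by (intro runs_seq)
  then show ?thesis by (rule runs_cong) auto
qed

section \<open>Reductions between problems on graphs\<close>

section \<open>Linear combinations of graph functionals\<close>

text \<open>Arbitrary integer functionals form a family closed under linear combinations, which
  contains both the counts for single constituents and their weighted sums.\<close>

definition graph_problem :: "nat \<Rightarrow> (nat graph \<Rightarrow> int) \<Rightarrow> problem" where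
  "graph_problem p f = {(enc_graph G, enc_residue (nat (f G mod int p))) | G. input_graph G}"

lemma Hom_problem_eq: "Hom_problem p H = graph_problem p (\<lambda>G. int (hom G H))"
  by (simp add: Hom_problem_def graph_problem_def flip: of_nat_mod)

lemma graph_problem_cong:
  "(\<And>G. input_graph G \<Longrightarrow> [f G = g G] (mod int p)) \<Longrightarrow> graph_problem p f = graph_problem p g"
  unfolding graph_problem_def cong_def by metis

lemma reducible_zero: "poly_turing_reducible (graph_problem p (\<lambda>_. 0)) B"
proof (rule poly_turing_reducible_runsI[where c = "clear 0" and T = "\<lambda>n. 2 * n + 1"])
  fix w a assume "(w, a) \<in> graph_problem p (\<lambda>_. 0)"
  then have "a = []" by (auto simp: graph_problem_def enc_residue_def)
  then show "\<exists>s. runs B (clear 0) (start [w]) (2 * length w + 1) s \<and> s 0 = a"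
    by (intro exI[of _ "(start [w])(0 := [])"] conjI runs_cong[OF runs_clear]) (auto simp: start_def)
qed (intro poly_bounded_intros)

text \<open>The subroutines leave the input in register 0, so it is still there for the second call.
  The two answers are residues, and a table indexed by both holds the result for the fixed
  \<open>c\<close> and \<open>d\<close>.\<close>

lemma reducible_linear:
  assumes "p > 0" and f: "poly_turing_reducible (graph_problem p f) B"
    and g: "poly_turing_reducible (graph_problem p g) B"
  shows "poly_turing_reducible (graph_problem p (\<lambda>G. c * f G + d * g G)) B"
proof -
  obtain cf qf where cf: "\<forall>w a. (w, a) \<in> graph_problem p f \<longrightarrow>
      (\<exists>s. runs B cf (start [w]) (poly qf (length w)) s \<and> s 0 = a)"
    using poly_turing_reducible_runsE[OF f] by blast
  obtain cg qg where cg: "\<forall>w a. (w, a) \<in> graph_problem p g \<longrightarrow>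
      (\<exists>s. runs B cg (start [w]) (poly qg (length w)) s \<and> s 0 = a)"
    using poly_turing_reducible_runsE[OF g] by blast
  let ?out = "\<lambda>a b. pushes 0 (enc_residue (nat ((c * int a + d * int b) mod int p)))"
  let ?c = "Seq (subroutine cf 3 0 1) (Seq (subroutine cg 3 0 2) (Seq (clear 0)
    (case_unary 1 p (\<lambda>a. case_unary 2 p (?out a)))))"
  let ?T = "\<lambda>n. (20 + 2 * width cf) * (n + 0 + poly qf n + 1) + ((20 + 2 * width cg) * (n + 0 + poly qg n + 1)
     + ((2 * n + 1) + ((p + 1 + 2 * p) + 2 * p)))"
  show ?thesis
  proof (rule poly_turing_reducible_runsI)
    show "poly_bounded ?T" by (intro poly_bounded_intros)
    fix w x assume "(w, x) \<in> graph_problem p (\<lambda>G. c * f G + d * g G)"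
    then obtain G where G: "input_graph G" "w = enc_graph G"
      "x = enc_residue (nat ((c * f G + d * g G) mod int p))" by (auto simp: graph_problem_def)
    define a where "a = nat (f G mod int p)"
    define b where "b = nat (g G mod int p)"
    have ab: "a \<le> p" "b \<le> p" "int a = f G mod int p" "int b = g G mod int p"
      using \<open>p > 0\<close> pos_mod_bound[of "int p" "f G"] pos_mod_bound[of "int p" "g G"]
      by (auto simp: a_def b_def nat_le_iff less_imp_le)
    have "(w, enc_residue a) \<in> graph_problem p f" "(w, enc_residue b) \<in> graph_problem p g"
      using G by (auto simp: graph_problem_def a_def b_def)
    then obtain sf sg where sf: "runs B cf (start [w]) (poly qf (length w)) sf" "sf 0 = enc_residue a"
      and sg: "runs B cg (start [w]) (poly qg (length w)) sg" "sg 0 = enc_residue b"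
      using cf cg by meson
    let ?s = "start [w]"
    have 1: "runs B (subroutine cf 3 0 1) ?s ((20 + 2 * width cf) * (length w + 0 + poly qf (length w) + 1))
       (?s(1 := enc_residue a))"
      by (rule runs_cong[OF runs_subroutine[OF sf]]) (auto simp: start_def)
    have 2: "runs B (subroutine cg 3 0 2) (?s(1 := enc_residue a))
       ((20 + 2 * width cg) * (length w + 0 + poly qg (length w) + 1)) (?s(1 := enc_residue a, 2 := enc_residue b))"
      by (rule runs_cong[OF runs_subroutine[OF sg]]) (auto simp: start_def)
    have 3: "runs B (clear 0) (?s(1 := enc_residue a, 2 := enc_residue b)) (2 * length w + 1)
       (?s(1 := enc_residue a, 2 := enc_residue b, 0 := []))"
      by (rule runs_cong[OF runs_clear]) (auto simp: start_def)
    have "(c * f G + d * g G) mod int p = (c * int a + d * int b) mod int p"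
      unfolding ab(3,4) by (intro mod_add_cong) (simp_all add: mod_mult_right_eq)
    then have x: "x = enc_residue (nat ((c * int a + d * int b) mod int p))" by (simp add: G(3))
    have "length x \<le> p" using \<open>p > 0\<close> pos_mod_bound[of "int p"] unfolding x enc_residue_def
      by (simp add: nat_le_iff less_imp_le)
    then have 4: "runs B (?out a b) (?s(1 := enc_residue a, 2 := enc_residue b, 0 := [], 1 := [], 2 := []))
       (p + 1) (?s(0 := x))"
      unfolding x[symmetric] by (intro runs_cong[OF runs_pushes]) (auto simp: fun_eq_iff start_def x enc_residue_def)
    have 5: "runs B (case_unary 1 p (\<lambda>a. case_unary 2 p (?out a)))
       (?s(1 := enc_residue a, 2 := enc_residue b, 0 := [])) ((p + 1 + 2 * p) + 2 * p) (?s(0 := x))"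
      by (rule runs_case_unary[where k = a], simp add: enc_residue_def, rule ab,
          rule runs_case_unary[where k = b], simp add: enc_residue_def, rule ab, rule 4)
    show "\<exists>s. runs B ?c ?s (?T (length w)) s \<and> s 0 = x"
      using runs_seq[OF 1 runs_seq[OF 2 runs_seq[OF 3 5]]]
      by (intro exI[of _ "?s(0 := x)"] conjI) simp_all
  qed
qed

lemma reducible_sum_list:
  assumes "p > 0" and "\<And>c f. (c, f) \<in> set xs \<Longrightarrow> poly_turing_reducible (graph_problem p f) B"
  shows "poly_turing_reducible (graph_problem p (\<lambda>G. \<Sum>(c, f) \<leftarrow> xs. c * f G)) B"
  using assms(2)
proof (induction xs)
  case Nil
  then show ?case using reducible_zero by simp
next
  case (Cons x xs)
  obtain c f where x: "x = (c, f)" by (cases x)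
  have "poly_turing_reducible (graph_problem p (\<lambda>G. c * f G + 1 * (\<Sum>(c, f) \<leftarrow> xs. c * f G))) B"
    using Cons x by (intro reducible_linear assms(1)) auto
  then show ?case by (simp add: x)
qed

section \<open>Disjoint unions\<close>

definition row :: "nat graph \<Rightarrow> nat \<Rightarrow> bool list" where
  "row G i = map (\<lambda>j. (i, j) \<in> edges G) [0..<card (verts G)]"

lemma length_row [simp]: "length (row G i) = card (verts G)"
  by (simp add: row_def)

lemma enc_graph_rows:
  "enc_graph G = replicate (card (verts G)) True @ False # concat (map (row G) [0..<card (verts G)])"
proof -
  have "map (\<lambda>ij. ij \<in> edges G) (List.product xs ys) = concat (map (\<lambda>i. map (\<lambda>j. (i, j) \<in> edges G) ys) xs)"
    for xs ys by (induction xs) auto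
  then show ?thesis by (simp add: enc_graph_def Let_def row_def[abs_def])
qed

lemma length_enc_graph: "length (enc_graph G) = card (verts G) + 1 + card (verts G) * card (verts G)"
  by (simp add: enc_graph_def Let_def)

text \<open>Shifting \<open>G\<close> past the vertices of \<open>F\<close> keeps the vertex set an
  initial segment of the natural numbers, so that the union is again a legal input.\<close>

definition graph_sum :: "nat graph \<Rightarrow> nat graph \<Rightarrow> nat graph" where
  "graph_sum F G = \<lparr>verts = {..<card (verts F) + card (verts G)},
     edges = edges F \<union> (\<lambda>(i, j). (card (verts F) + i, card (verts F) + j)) ` edges G\<rparr>"

lemma input_graph_edges:
  assumes "input_graph G" "(i, j) \<in> edges G"
  shows "i < card (verts G)" "j < card (verts G)"
  using assms by (auto simp: input_graph_def is_graph_def)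

lemma input_graph_verts: "input_graph G \<Longrightarrow> verts G = {..<card (verts G)}"
  unfolding input_graph_def by (metis card_lessThan)

lemma card_verts_graph_sum [simp]: "card (verts (graph_sum F G)) = card (verts F) + card (verts G)"
  by (simp add: graph_sum_def)

lemma input_graph_graph_sum:
  assumes "input_graph F" "input_graph G"
  shows "input_graph (graph_sum F G)"
  unfolding input_graph_def is_graph_def
proof (intro conjI exI)
  show "sym (edges (graph_sum F G))"
    using assms by (auto simp: input_graph_def is_graph_def graph_sum_def sym_def)
  show "edges (graph_sum F G) \<subseteq> verts (graph_sum F G) \<times> verts (graph_sum F G)"
    using input_graph_edges[OF assms(1)] input_graph_edges[OF assms(2)]
    by (fastforce simp: graph_sum_def)
qed (auto simp: graph_sum_def)

lemma edges_graph_sum: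
  assumes "input_graph F"
  shows "i < card (verts F) \<Longrightarrow> (i, j) \<in> edges (graph_sum F G) \<longleftrightarrow> (i, j) \<in> edges F"
    and "(card (verts F) + i, j) \<in> edges (graph_sum F G) \<longleftrightarrow>
      card (verts F) \<le> j \<and> (i, j - card (verts F)) \<in> edges G"
proof -
  assume "i < card (verts F)"
  then show "(i, j) \<in> edges (graph_sum F G) \<longleftrightarrow> (i, j) \<in> edges F"
    by (auto simp: graph_sum_def)
next
  have "(card (verts F) + i, j) \<notin> edges F" using input_graph_edges(1)[OF assms] by fastforce
  then show "(card (verts F) + i, j) \<in> edges (graph_sum F G) \<longleftrightarrow>
      card (verts F) \<le> j \<and> (i, j - card (verts F)) \<in> edges G"
    by (auto simp: graph_sum_def image_iff intro!: bexI[of _ "(i, j - card (verts F))"])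
qed

text \<open>The adjacency matrix of a disjoint union is block diagonal.\<close>

lemma row_graph_sum:
  assumes "input_graph F" "input_graph G"
  shows "i < card (verts F) \<Longrightarrow> row (graph_sum F G) i = row F i @ replicate (card (verts G)) False"
    and "row (graph_sum F G) (card (verts F) + i) = replicate (card (verts F)) False @ row G i"
proof -
  assume "i < card (verts F)"
  then show "row (graph_sum F G) i = row F i @ replicate (card (verts G)) False"
    using input_graph_edges(2)[OF assms(1)]
    by (intro nth_equalityI) (auto simp: row_def nth_append edges_graph_sum(1)[OF assms(1)])
next
  show "row (graph_sum F G) (card (verts F) + i) = replicate (card (verts F)) False @ row G i"
    by (intro nth_equalityI) (auto simp: row_def nth_append edges_graph_sum(2)[OF assms(1)])
qed

lemma enc_graph_sum:
  assumes "input_graph F" "input_graph G"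
  defines "m \<equiv> card (verts F)" and "n \<equiv> card (verts G)"
  shows "enc_graph (graph_sum F G) = replicate m True @ replicate n True @ False #
    concat (map (\<lambda>i. row F i @ replicate n False) [0..<m]) @
    concat (map (\<lambda>i. replicate m False @ row G i) [0..<n])"
proof -
  have 1: "map (row (graph_sum F G)) [0..<m] = map (\<lambda>i. row F i @ replicate n False) [0..<m]"
    using row_graph_sum[OF assms(1,2)] by (auto simp: m_def n_def)
  have 2: "map (row (graph_sum F G)) [m..<m + n] = map (\<lambda>i. replicate m False @ row G i) [0..<n]"
    using row_graph_sum(2)[OF assms(1,2)]
    by (intro nth_equalityI) (simp_all add: m_def n_def)
  have "[0..<m + n] = [0..<m] @ [m..<m + n]" using upt_add_eq_append[of 0 m n] by simp
  then show ?thesis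
    unfolding enc_graph_rows card_verts_graph_sum m_def[symmetric] n_def[symmetric]
    by (simp add: 1 2 replicate_add)
qed

section \<open>Querying disjoint unions\<close>

text \<open>The query \<open>1 (F + G)\<close> for the input graph \<open>G\<close> in register 0 is written in reverse to register 1 and
  moved to register 4. The prefix \<open>True, False, True, True, False\<close> encodes the presence of a term and
  its coefficient 1; registers 2 and 3 hold the number of vertices of \<open>G\<close>, and 5 is a flag.\<close>

definition write_sum :: "nat graph \<Rightarrow> com" where
  "write_sum F = (let m = card (verts F) in
     Seq (pushes 1 ([True, False, True, True, False] @ replicate m True)) (Seq (parse_unary 0 5 2)
     (Seq (repeat 2 3 (Push 1 True)) (Seq (Push 1 False)
     (Seq (for_each (\<lambda>i. Seq (pushes 1 (row F i)) (repeat 2 3 (Push 1 False))) [0..<m])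
     (Seq (While 0 (Seq (pushes 1 (replicate m False)) (repeat 2 3 (move1 0 1))))
     (Seq (Push 1 False) (drain 1 4))))))))"

lemma runs_write_sum:
  assumes F: "input_graph F" and G: "input_graph G"
  defines "m \<equiv> card (verts F)" and "n \<equiv> card (verts G)"
  shows "runs B (write_sum F) (start [enc_graph G])
     ((6 + m) + ((4 * n + 6) + ((n * (1 + 7) + 2) + (1 + ((m * ((m + 1) + (n * (1 + 7) + 2)) + 1)
      + ((n * Suc ((m + 1) + (n * (3 + 7) + 2)) + 1) + (1 + (4 * (8 + (m + n) + (m + n) * (m + n)) + 1))))))))
     ((start [])(2 := replicate n True, 4 := [True, False, True, True, False] @ enc_graph (graph_sum F G) @ [False]))"
proof -
  let ?s = "start []"
  let ?rows = "map (row G) [0..<n]"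
  \<comment> \<open>\<open>?h\<close> and its extensions \<open>?h1\<close>, \<open>?h2\<close>,
    \<open>?h3\<close> are the growing prefixes of the query; register 1 holds them
    reversed.\<close>
  let ?h = "[True, False, True, True, False] @ replicate m True"
  let ?N = "replicate n True"
  have s0: "?s i = []" for i by (simp add: start_def)
  have 1: "runs B (pushes 1 ?h) (start [enc_graph G]) (6 + m) (?s(0 := enc_graph G, 1 := rev ?h))"
    by (rule runs_cong[OF runs_pushes]) (auto simp: start_def fun_eq_iff)
  have 2: "runs B (parse_unary 0 5 2) (?s(0 := enc_graph G, 1 := rev ?h)) (4 * n + 6)
      (?s(0 := concat ?rows, 1 := rev ?h, 2 := ?N))"
    by (rule runs_cong[OF runs_parse_unary[where n = n and xs = "concat ?rows"]])
      (auto simp: start_def fun_eq_iff enc_graph_rows n_def)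
  let ?h1 = "?h @ ?N"
  have 3: "runs B (repeat 2 3 (Push 1 True)) (?s(0 := concat ?rows, 1 := rev ?h, 2 := ?N)) (n * (1 + 7) + 2)
      (?s(0 := concat ?rows, 1 := rev ?h1, 2 := ?N))"
  proof (rule runs_cong_start)
    let ?\<sigma> = "\<lambda>i. ?s(0 := concat ?rows, 1 := replicate i True @ rev ?h, 2 := ?N)"
    show "runs B (repeat 2 3 (Push 1 True)) (?\<sigma> 0) (n * (1 + 7) + 2) (?\<sigma> n)"
      by (rule runs_repeat) (auto simp: s0 fun_eq_iff intro!: runs_cong[OF runs_push])
  qed (auto simp: fun_eq_iff)
  let ?h2 = "?h1 @ [False]"
  have 4: "runs B (Push 1 False) (?s(0 := concat ?rows, 1 := rev ?h1, 2 := ?N)) 1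
      (?s(0 := concat ?rows, 1 := rev ?h2, 2 := ?N))"
    by (rule runs_cong[OF runs_push]) (auto simp: fun_eq_iff)
  have false_block: "runs B (repeat 2 3 (Push 1 False)) (?s(0 := x, 1 := y, 2 := ?N)) (n * (1 + 7) + 2)
      (?s(0 := x, 1 := replicate n False @ y, 2 := ?N))" for x y
  proof (rule runs_cong_start)
    let ?\<sigma> = "\<lambda>i. ?s(0 := x, 1 := replicate i False @ y, 2 := ?N)"
    show "runs B (repeat 2 3 (Push 1 False)) (?\<sigma> 0) (n * (1 + 7) + 2) (?\<sigma> n)"
      by (rule runs_repeat) (auto simp: s0 fun_eq_iff intro!: runs_cong[OF runs_push])
  qed (auto simp: fun_eq_iff)
  let ?R1 = "\<lambda>k. concat (map (\<lambda>i. row F i @ replicate n False) [0..<k])"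
  have 5: "runs B (for_each (\<lambda>i. Seq (pushes 1 (row F i)) (repeat 2 3 (Push 1 False))) [0..<m])
      (?s(0 := concat ?rows, 1 := rev ?h2, 2 := ?N)) (m * ((m + 1) + (n * (1 + 7) + 2)) + 1)
      (?s(0 := concat ?rows, 1 := rev (?h2 @ ?R1 m), 2 := ?N))"
  proof (rule runs_cong_start)
    let ?\<sigma> = "\<lambda>k. ?s(0 := concat ?rows, 1 := rev (?h2 @ ?R1 k), 2 := ?N)"
    show "runs B (for_each (\<lambda>i. Seq (pushes 1 (row F i)) (repeat 2 3 (Push 1 False))) [0..<m])
      (?\<sigma> 0) (length [0..<m] * ((m + 1) + (n * (1 + 7) + 2)) + 1) (?\<sigma> (length [0..<m]))"
    proof (rule runs_for_each)
      fix i assume i: "i < length [0..<m]"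
      have "runs B (pushes 1 (row F i)) (?\<sigma> i) (m + 1)
         (?s(0 := concat ?rows, 1 := rev (row F i) @ rev (?h2 @ ?R1 i), 2 := ?N))"
        by (rule runs_cong[OF runs_pushes]) (auto simp: fun_eq_iff m_def)
      from runs_seq[OF this false_block] have "runs B (Seq (pushes 1 (row F i)) (repeat 2 3 (Push 1 False)))
         (?\<sigma> i) ((m + 1) + (n * (1 + 7) + 2)) (?\<sigma> (Suc i))"
        by (rule runs_cong) (auto simp: fun_eq_iff)
      moreover have "[0..<m] ! i = i" using i by simp
      ultimately show "runs B (Seq (pushes 1 (row F ([0..<m] ! i))) (repeat 2 3 (Push 1 False))) (?\<sigma> i)
         ((m + 1) + (n * (1 + 7) + 2)) (?\<sigma> (Suc i))" by metis
    qed
  qed (auto simp: fun_eq_iff)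
  let ?h3 = "?h2 @ ?R1 m"
  let ?R2 = "\<lambda>k. concat (map (\<lambda>i. replicate m False @ row G i) [0..<k])"
  let ?c = "Seq (pushes 1 (replicate m False)) (repeat 2 3 (move1 0 1))"
  have 6: "runs B (While 0 ?c) (?s(0 := concat ?rows, 1 := rev ?h3, 2 := ?N))
      (n * Suc ((m + 1) + (n * (3 + 7) + 2)) + 1) (?s(0 := [], 1 := rev (?h3 @ ?R2 n), 2 := ?N))"
  proof (rule runs_cong_start)
    let ?\<sigma> = "\<lambda>k. ?s(0 := concat (drop k ?rows), 1 := rev (?h3 @ ?R2 k), 2 := ?N)"
    show "runs B (While 0 ?c) (?\<sigma> 0) (n * Suc ((m + 1) + (n * (3 + 7) + 2)) + 1) (?\<sigma> n)"
    proof (rule runs_while)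
      fix i assume i: "i < n"
      let ?x = "concat (drop (Suc i) ?rows)"
      let ?y = "replicate m False @ rev (?h3 @ ?R2 i)"
      have d: "concat (drop i ?rows) = row G i @ ?x"
        using i by (simp flip: Cons_nth_drop_Suc)
      have len: "length (row G i) = n" by (simp add: n_def)
      have a: "runs B (pushes 1 (replicate m False)) (?\<sigma> i) (m + 1) (?s(0 := row G i @ ?x, 1 := ?y, 2 := ?N))"
        by (rule runs_cong[OF runs_pushes]) (use d in \<open>auto simp: fun_eq_iff\<close>)
      have b: "runs B (repeat 2 3 (move1 0 1)) (?s(0 := row G i @ ?x, 1 := ?y, 2 := ?N)) (n * (3 + 7) + 2)
          (?s(0 := ?x, 1 := rev (row G i) @ ?y, 2 := ?N))"
      proof (rule runs_cong_start)
        let ?\<tau> = "\<lambda>j. ?s(0 := drop j (row G i) @ ?x, 1 := rev (take j (row G i)) @ ?y, 2 := ?N)"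
        show "runs B (repeat 2 3 (move1 0 1)) (?\<tau> 0) (n * (3 + 7) + 2) (?\<tau> n)"
        proof (rule runs_repeat)
          fix j x y assume j: "j < n"
          then have "drop j (row G i) = row G i ! j # drop (Suc j) (row G i)"
            using len by (simp add: Cons_nth_drop_Suc)
          with j show "runs B (move1 0 1) ((?\<tau> j)(2 := x, 3 := y)) 3 ((?\<tau> (Suc j))(2 := x, 3 := y))"
            by (intro runs_cong[OF runs_move1[where x = "row G i ! j" and xs = "drop (Suc j) (row G i) @ ?x"]])
              (auto simp: fun_eq_iff take_Suc_conv_app_nth n_def)
        qed (auto simp: s0)
      qed (auto simp: fun_eq_iff n_def)
      have "runs B ?c (?\<sigma> i) ((m + 1) + (n * (3 + 7) + 2)) (?\<sigma> (Suc i))"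
        using runs_seq[OF a b] by (rule runs_cong) (auto simp: fun_eq_iff)
      \<comment> \<open>The loop test sees only whether input bits remain; as rows are nonempty
        while \<open>i < n\<close>, it fails exactly after the last row.\<close>
      moreover have "row G i \<noteq> []" using i len by (metis list.size(3) not_less_zero)
      then have "?\<sigma> i 0 \<noteq> []" using d by simp
      ultimately show "?\<sigma> i 0 \<noteq> [] \<and> runs B ?c (?\<sigma> i) ((m + 1) + (n * (3 + 7) + 2)) (?\<sigma> (Suc i))" by blast
    qed simp
  qed (auto simp: fun_eq_iff)
  let ?w = "[True, False, True, True, False] @ enc_graph (graph_sum F G) @ [False]"
  have w: "?w = ?h3 @ ?R2 n @ [False]"
    by (simp add: enc_graph_sum[OF F G] m_def n_def)
  have 7: "runs B (Push 1 False) (?s(0 := [], 1 := rev (?h3 @ ?R2 n), 2 := ?N)) 1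
      (?s(0 := [], 1 := rev ?w, 2 := ?N))"
    unfolding w by (rule runs_cong[OF runs_push]) (auto simp: fun_eq_iff)
  have lw: "length ?w \<le> 8 + (m + n) + (m + n) * (m + n)"
    by (simp add: length_enc_graph m_def n_def)
  have 8: "runs B (drain 1 4) (?s(0 := [], 1 := rev ?w, 2 := ?N))
      (4 * (8 + (m + n) + (m + n) * (m + n)) + 1) (?s(2 := ?N, 4 := ?w))"
  proof (rule runs_cong[OF runs_drain])
    show "4 * length ((?s(0 := [], 1 := rev ?w, 2 := ?N)) 1) + 1 \<le> 4 * (8 + (m + n) + (m + n) * (m + n)) + 1"
      using lw by (intro add_mono mult_le_mono) simp_all
  qed (auto simp: fun_eq_iff s0)
  show ?thesis unfolding write_sum_def Let_def m_def[symmetric]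
    by (intro runs_seq[OF 1] runs_seq[OF 2] runs_seq[OF 3] runs_seq[OF 4] runs_seq[OF 5] runs_seq[OF 6]
        runs_seq[OF 7] 8)
qed

lemma enc_quantum_single:
  "enc_quantum (Poly_Mapping.single G 1) [G] = [True, False, True, True, False] @ enc_graph G @ [False]"
proof -
  have "bits 1 = [True]" by (simp add: bits.simps[of "Suc 0"] bits.simps[of 0])
  then show ?thesis by (simp add: enc_quantum_def enc_int_def)
qed

text \<open>With a single term the promise of pairwise non-isomorphism holds trivially, so the
  oracle does not block.\<close>

lemma quantum_query:
  assumes "input_graph G"
  shows "(enc_quantum (Poly_Mapping.single G 1) [G],
     enc_residue (nat (qhom (Poly_Mapping.single G 1) Hbar mod int p))) \<in> QHom_problem p Hbar"
proof -
  have "quantum_graph (Poly_Mapping.single G 1)"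
    using assms by (auto simp: quantum_graph_def input_graph_def)
  then show ?thesis
    using assms unfolding QHom_problem_def by (intro CollectI exI[of _ "Poly_Mapping.single G 1"] exI[of _ "[G]"]) auto
qed

lemma reducible_graph_sum:
  assumes p: "p > 0" and F: "input_graph F"
  shows "poly_turing_reducible
    (graph_problem p (\<lambda>G. qhom (Poly_Mapping.single (graph_sum F G) 1) Hbar)) (QHom_problem p Hbar)"
proof -
  let ?c = "Seq (write_sum F) (Ask 4 0)"
  define m where "m = card (verts F)"
  let ?T = "\<lambda>n. (6 + m) + ((4 * n + 6) + ((n * (1 + 7) + 2) + (1 + ((m * ((m + 1) + (n * (1 + 7) + 2)) + 1)
      + ((n * Suc ((m + 1) + (n * (3 + 7) + 2)) + 1) + (1 + (4 * (8 + (m + n) + (m + n) * (m + n)) + 1)))))))"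
  show ?thesis
  proof (rule poly_turing_reducible_runsI)
    show "poly_bounded (\<lambda>n. ?T n + Suc p)" by (intro poly_bounded_intros)
    fix w x assume "(w, x) \<in> graph_problem p (\<lambda>G. qhom (Poly_Mapping.single (graph_sum F G) 1) Hbar)"
    then obtain G where G: "input_graph G" "w = enc_graph G"
      "x = enc_residue (nat (qhom (Poly_Mapping.single (graph_sum F G) 1) Hbar mod int p))"
      by (auto simp: graph_problem_def)
    let ?s = "(start [])(2 := replicate (card (verts G)) True,
      4 := [True, False, True, True, False] @ enc_graph (graph_sum F G) @ [False])"
    have "(?s 4, x) \<in> QHom_problem p Hbar"
      using quantum_query[OF input_graph_graph_sum[OF F G(1)]]
      unfolding enc_quantum_single G(3) by simp
    moreover have "length x \<le> p"
      using p unfolding G(3) enc_residue_def by (simp add: nat_le_iff less_imp_le)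
    ultimately have ask: "runs (QHom_problem p Hbar) (Ask 4 0) ?s (Suc p) (?s(0 := x))"
      by (intro runs_cong[OF runs_ask]) auto
    \<comment> \<open>The time is known in terms of the number of vertices; the bound is monotone,
      so it may be taken at the input length instead.\<close>
    have n: "card (verts G) \<le> length w" by (simp add: G(2) length_enc_graph)
    have "runs (QHom_problem p Hbar) ?c (start [w]) (?T (length w) + Suc p) (?s(0 := x))"
      using runs_seq[OF runs_write_sum[OF F G(1), folded m_def] ask, folded G(2)]
      by (rule runs_cong) (intro add_mono mult_le_mono order_refl Suc_le_mono[THEN iffD2] n, rule refl)
    then show "\<exists>s. runs (QHom_problem p Hbar) ?c (start [w]) (?T (length w) + Suc p) s \<and> s 0 = x"
      by (intro exI[of _ "?s(0 := x)"] conjI) simp_all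
  qed
qed

section \<open>Evaluating quantum graphs\<close>

text \<open>Register 0 holds the remaining input, 1 the partial sum modulo \<open>p\<close>, 2 and 3 the absolute value modulo
  \<open>p\<close> and the sign of the current coefficient, 4 to 8 are used for parsing the current graph, 9 and 10
  are the query and its answer, and 11 and 12 are the flags of the loops over terms and digits.\<close>

definition add_digit :: "nat \<Rightarrow> nat \<Rightarrow> com" where
  "add_digit p b = case_unary 2 p (\<lambda>k. pushes 2 (enc_residue ((2 * k + b) mod p)))"

lemma runs_add_digit:
  assumes "p > 0" "s 2 = enc_residue k" "k < p"
  shows "runs B (add_digit p b) s (3 * p + 1) (s(2 := enc_residue ((2 * k + b) mod p)))"
proof -
  have "runs B (pushes 2 (enc_residue ((2 * k + b) mod p))) (s(2 := [])) (p + 1)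
     (s(2 := enc_residue ((2 * k + b) mod p)))"
    using assms(1) by (intro runs_cong[OF runs_pushes]) (auto simp: enc_residue_def fun_eq_iff less_imp_le)
  then have "runs B (add_digit p b) s ((p + 1) + 2 * p) (s(2 := enc_residue ((2 * k + b) mod p)))"
    unfolding add_digit_def using assms by (intro runs_case_unary[where k = k]) (auto simp: enc_residue_def)
  then show ?thesis by (rule runs_cong) auto
qed

definition parse_digit :: "nat \<Rightarrow> com" where
  "parse_digit p = Branch 0 Skip (Seq (Pop 0) (Pop 12))
     (Seq (Pop 0) (Branch 0 Skip (Seq (Pop 0) (add_digit p 0)) (Seq (Pop 0) (add_digit p 1))))"

definition parse_int :: "nat \<Rightarrow> com" where
  "parse_int p = Seq (Branch 0 Skip (Pop 0) (Seq (Pop 0) (Push 3 True)))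
     (Seq (Push 12 True) (While 12 (parse_digit p)))"

lemma runs_parse_digit:
  assumes "p > 0" "s 2 = enc_residue k" "k < p" "s 0 = True # b # xs"
  shows "runs B (parse_digit p) s (3 * p + 5) (s(0 := xs, 2 := enc_residue ((2 * k + of_bool b) mod p)))"
proof -
  have 1: "runs B (Pop 0) s 1 (s(0 := b # xs))"
    by (rule runs_cong[OF runs_pop]) (use assms in auto)
  have 2: "runs B (Pop 0) (s(0 := b # xs)) 1 (s(0 := xs))"
    by (rule runs_cong[OF runs_pop]) (use assms in auto)
  have 3: "runs B (add_digit p (of_bool b)) (s(0 := xs)) (3 * p + 1)
     (s(0 := xs, 2 := enc_residue ((2 * k + of_bool b) mod p)))"
    using assms by (intro runs_add_digit) auto
  have "runs B (Branch 0 Skip (Seq (Pop 0) (add_digit p 0)) (Seq (Pop 0) (add_digit p 1))) (s(0 := b # xs))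
     (Suc (1 + (3 * p + 1))) (s(0 := xs, 2 := enc_residue ((2 * k + of_bool b) mod p)))"
  proof (cases b)
    case True
    with runs_branch_True[OF _ runs_seq[OF 2 3]] show ?thesis by simp
  next
    case False
    with runs_branch_False[OF _ runs_seq[OF 2 3]] show ?thesis by simp
  qed
  from runs_branch_True[OF assms(4) runs_seq[OF 1 this]] show ?thesis
    unfolding parse_digit_def by (rule runs_cong) auto
qed

text \<open>Horner's scheme with a reduction after each digit: the digit that \<open>bits\<close>
  appends is the one that \<open>foldl\<close> processes last.\<close>

lemma foldl_digits: "foldl (\<lambda>k b. (2 * k + of_bool b) mod p) 0 (bits n) = n mod p" for p :: nat
proof (induction n rule: bits.induct)
  case (1 n)
  show ?case
  proof (cases "n = 0")
    case True
    then show ?thesis by (simp add: bits.simps[of 0])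
  next
    case False
    have "(2 * (n div 2 mod p) + of_bool (odd n)) mod p = (2 * (n div 2) + of_bool (odd n)) mod p"
      by (metis mod_add_left_eq mod_mult_right_eq)
    also have "2 * (n div 2) + of_bool (odd n) = n" by (cases "even n") auto
    finally show ?thesis using 1 False by (subst bits.simps) simp
  qed
qed

lemma runs_parse_int:
  assumes p: "p > 0" and s: "s 0 = enc_int z @ xs" "s 2 = []" "s 3 = []" "s 12 = []"
    and L: "length (enc_int z) \<le> L"
  shows "runs B (parse_int p) s (3 + (1 + (Suc L * Suc (3 * p + 5) + 1)))
    (s(0 := xs, 2 := enc_residue (nat \<bar>z\<bar> mod p), 3 := if z < 0 then [True] else []))"
proof -
  let ?bs = "bits (nat \<bar>z\<bar>)"
  let ?w = "\<lambda>bs. concat (map (\<lambda>b. [True, b]) bs) @ False # xs"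
  let ?sg = "if z < 0 then [True] else []"
  let ?h = "\<lambda>i. foldl (\<lambda>k b. (2 * k + of_bool b) mod p) 0 (take i ?bs)"
  have h: "?h i < p" for i using p by (cases "take i ?bs" rule: rev_cases) auto
  have s0: "s 0 = (z < 0) # ?w ?bs" using s by (simp add: enc_int_def)
  have 1: "runs B (Branch 0 Skip (Pop 0) (Seq (Pop 0) (Push 3 True))) s 3 (s(0 := ?w ?bs, 3 := ?sg))"
  proof (cases "z < 0")
    case True
    with s0 s show ?thesis
      by (intro runs_cong[OF runs_branch_True[OF _ runs_seq[OF runs_pop runs_push]]]) (auto simp: fun_eq_iff)
  next
    case False
    with s0 s show ?thesis
      by (intro runs_cong[OF runs_branch_False[OF _ runs_pop]]) (auto simp: fun_eq_iff)
  qed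
  have 2: "runs B (Push 12 True) (s(0 := ?w ?bs, 3 := ?sg)) 1 (s(0 := ?w ?bs, 3 := ?sg, 12 := [True]))"
    by (rule runs_cong[OF runs_push]) (use s in \<open>auto simp: fun_eq_iff\<close>)
  let ?n = "length ?bs"
  let ?\<sigma> = "\<lambda>i. if i \<le> ?n then s(0 := ?w (drop i ?bs), 2 := enc_residue (?h i), 3 := ?sg, 12 := [True])
    else s(0 := xs, 2 := enc_residue (?h ?n), 3 := ?sg)"
  have "runs B (While 12 (parse_digit p)) (?\<sigma> 0) (Suc ?n * Suc (3 * p + 5) + 1) (?\<sigma> (Suc ?n))"
  proof (rule runs_while)
    fix i assume i: "i < Suc ?n"
    have "runs B (parse_digit p) (?\<sigma> i) (3 * p + 5) (?\<sigma> (Suc i))"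
    proof (cases "i = ?n")
      case True
      with s show ?thesis unfolding parse_digit_def
        by (intro runs_cong[OF runs_branch_False[OF _ runs_seq[OF runs_pop runs_pop]]]) (auto simp: fun_eq_iff)
    next
      case False
      with i have i': "i < ?n" by simp
      then have "drop i ?bs = ?bs ! i # drop (Suc i) ?bs" by (simp add: Cons_nth_drop_Suc)
      moreover have "?h (Suc i) = (2 * ?h i + of_bool (?bs ! i)) mod p"
        using i' by (simp add: take_Suc_conv_app_nth)
      ultimately show ?thesis
        using i' h p by (intro runs_cong[OF runs_parse_digit[where k = "?h i" and b = "?bs ! i"
              and xs = "?w (drop (Suc i) ?bs)"]]) (auto simp: fun_eq_iff)
    qed
    then show "?\<sigma> i 12 \<noteq> [] \<and> runs B (parse_digit p) (?\<sigma> i) (3 * p + 5) (?\<sigma> (Suc i))" using i by simp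
  qed (use s in simp)
  moreover have "?n \<le> length (enc_int z)"
    by (simp add: enc_int_def length_concat comp_def sum_list_triv)
  ultimately have 3: "runs B (While 12 (parse_digit p)) (s(0 := ?w ?bs, 3 := ?sg, 12 := [True]))
      (Suc L * Suc (3 * p + 5) + 1) (s(0 := xs, 2 := enc_residue (nat \<bar>z\<bar> mod p), 3 := ?sg))"
  proof (elim runs_cong_start)
    assume "?n \<le> length (enc_int z)"
    then show "Suc ?n * Suc (3 * p + 5) + 1 \<le> Suc L * Suc (3 * p + 5) + 1"
      using L by (intro add_mono mult_le_mono1) auto
  qed (use s in \<open>auto simp: fun_eq_iff foldl_digits enc_residue_def\<close>)
  show ?thesis unfolding parse_int_def by (rule runs_seq[OF 1 runs_seq[OF 2 3]])
qed

text \<open>The adjacency matrix has no end mark, so its \<open>n * n\<close> bits are counted off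
  by two nested loops. These need separate counters, hence the copies of \<open>n\<close> in
  registers 4 and 6.\<close>

definition parse_graph :: com where
  "parse_graph = Seq (parse_unary 0 12 4) (Seq (repeat 4 5 (Seq (Push 6 True) (Push 8 True)))
     (Seq (Push 8 False) (Seq (repeat 4 5 (repeat 6 7 (move1 0 8)))
     (Seq (clear 4) (Seq (clear 6) (drain 8 9))))))"

lemma runs_parse_graph:
  assumes s: "s 0 = enc_graph G @ xs" "s 4 = []" "s 5 = []" "s 6 = []" "s 7 = []" "s 8 = []" "s 9 = []" "s 12 = []"
  defines "n \<equiv> card (verts G)"
  shows "runs B parse_graph s ((4 * n + 6) + ((n * (2 + 7) + 2) + (1 + ((n * ((n * (3 + 7) + 2) + 7) + 2)
     + ((2 * n + 1) + ((2 * n + 1) + (4 * (n + 1 + n * n) + 1))))))) (s(0 := xs, 9 := enc_graph G))"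
proof -
  let ?rows = "map (row G) [0..<n]"
  let ?N = "replicate n True"
  let ?x = "concat ?rows @ xs"
  have 1: "runs B (parse_unary 0 12 4) s (4 * n + 6) (s(0 := ?x, 4 := ?N))"
    by (rule runs_cong[OF runs_parse_unary[where n = n and xs = ?x]])
      (use s in \<open>auto simp: fun_eq_iff enc_graph_rows n_def\<close>)
  have 2: "runs B (repeat 4 5 (Seq (Push 6 True) (Push 8 True))) (s(0 := ?x, 4 := ?N)) (n * (2 + 7) + 2)
     (s(0 := ?x, 4 := ?N, 6 := ?N, 8 := ?N))"
  proof (rule runs_cong_start)
    let ?\<sigma> = "\<lambda>i. s(0 := ?x, 4 := ?N, 6 := replicate i True, 8 := replicate i True)"
    show "runs B (repeat 4 5 (Seq (Push 6 True) (Push 8 True))) (?\<sigma> 0) (n * (2 + 7) + 2) (?\<sigma> n)"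
      by (rule runs_repeat) (use s in \<open>auto simp: fun_eq_iff intro!: runs_cong[OF runs_seq[OF runs_push runs_push]]\<close>)
  qed (use s in \<open>auto simp: fun_eq_iff\<close>)
  let ?h = "?N @ [False]"
  have 3: "runs B (Push 8 False) (s(0 := ?x, 4 := ?N, 6 := ?N, 8 := ?N)) 1 (s(0 := ?x, 4 := ?N, 6 := ?N, 8 := rev ?h))"
    by (rule runs_cong[OF runs_push]) (auto simp: fun_eq_iff)
  have 4: "runs B (repeat 4 5 (repeat 6 7 (move1 0 8))) (s(0 := ?x, 4 := ?N, 6 := ?N, 8 := rev ?h))
     (n * ((n * (3 + 7) + 2) + 7) + 2) (s(0 := xs, 4 := ?N, 6 := ?N, 8 := rev (?h @ concat ?rows)))"
  proof (rule runs_cong_start)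
    let ?\<sigma> = "\<lambda>k. s(0 := concat (drop k ?rows) @ xs, 4 := ?N, 6 := ?N, 8 := rev (?h @ concat (take k ?rows)))"
    show "runs B (repeat 4 5 (repeat 6 7 (move1 0 8))) (?\<sigma> 0) (n * ((n * (3 + 7) + 2) + 7) + 2) (?\<sigma> n)"
    proof (rule runs_repeat)
      fix i u v assume i: "i < n"
      let ?r = "row G i" and ?y = "concat (drop (Suc i) ?rows) @ xs" and ?z = "rev (?h @ concat (take i ?rows))"
      have d: "concat (drop i ?rows) @ xs = ?r @ ?y"
        using i by (simp flip: Cons_nth_drop_Suc)
      have len: "length ?r = n" by (simp add: n_def)
      show "runs B (repeat 6 7 (move1 0 8)) ((?\<sigma> i)(4 := u, 5 := v)) (n * (3 + 7) + 2) ((?\<sigma> (Suc i))(4 := u, 5 := v))"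
      proof (rule runs_cong_start)
        let ?\<tau> = "\<lambda>j. s(0 := drop j ?r @ ?y, 4 := u, 5 := v, 6 := ?N, 8 := rev (take j ?r) @ ?z)"
        show "runs B (repeat 6 7 (move1 0 8)) (?\<tau> 0) (n * (3 + 7) + 2) (?\<tau> n)"
        proof (rule runs_repeat)
          fix j x y assume j: "j < n"
          then have "drop j ?r = ?r ! j # drop (Suc j) ?r"
            using len by (simp add: Cons_nth_drop_Suc)
          with j show "runs B (move1 0 8) ((?\<tau> j)(6 := x, 7 := y)) 3 ((?\<tau> (Suc j))(6 := x, 7 := y))"
            by (intro runs_cong[OF runs_move1[where x = "?r ! j" and xs = "drop (Suc j) ?r @ ?y"]])
              (auto simp: fun_eq_iff take_Suc_conv_app_nth n_def)
        qed (use s in auto)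
        show "s(0 := drop 0 ?r @ ?y, 4 := u, 5 := v, 6 := ?N, 8 := rev (take 0 ?r) @ ?z) = (?\<sigma> i)(4 := u, 5 := v)"
          unfolding d by (auto simp: fun_eq_iff)
        show "?\<tau> n = (?\<sigma> (Suc i))(4 := u, 5 := v)"
          using i by (auto simp: fun_eq_iff n_def take_Suc_conv_app_nth)
      qed simp
    qed (use s in auto)
  qed (auto simp: fun_eq_iff)
  let ?w = "?h @ concat ?rows"
  have w: "enc_graph G = ?w" by (simp add: enc_graph_rows n_def)
  have 5: "runs B (clear 4) (s(0 := xs, 4 := ?N, 6 := ?N, 8 := rev ?w)) (2 * n + 1) (s(0 := xs, 6 := ?N, 8 := rev ?w))"
    by (rule runs_cong[OF runs_clear]) (use s in \<open>auto simp: fun_eq_iff\<close>)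
  have 6: "runs B (clear 6) (s(0 := xs, 6 := ?N, 8 := rev ?w)) (2 * n + 1) (s(0 := xs, 8 := rev ?w))"
    by (rule runs_cong[OF runs_clear]) (use s in \<open>auto simp: fun_eq_iff\<close>)
  have "length ?w = n + 1 + n * n" using length_enc_graph[of G] unfolding w n_def .
  then have 7: "runs B (drain 8 9) (s(0 := xs, 8 := rev ?w)) (4 * (n + 1 + n * n) + 1) (s(0 := xs, 9 := enc_graph G))"
    unfolding w by (intro runs_cong[OF runs_drain]) (use s in \<open>auto simp: fun_eq_iff\<close>)
  show ?thesis unfolding parse_graph_def
    by (rule runs_seq[OF 1 runs_seq[OF 2 runs_seq[OF 3 runs_seq[OF 4 runs_seq[OF 5 runs_seq[OF 6 7]]]]]])
qed

definition update_sum :: "nat \<Rightarrow> com" where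
  "update_sum p = case_unary 1 p (\<lambda>a. case_unary 2 p (\<lambda>c. case_unary 3 1 (\<lambda>e. case_unary 10 p (\<lambda>b.
     pushes 1 (enc_residue (nat ((int a + (if e = 0 then int c else - int c) * int b) mod int p)))))))"

lemma runs_update_sum:
  assumes p: "p > 0" and s: "s 1 = enc_residue a" "s 2 = enc_residue c" "s 3 = enc_residue e" "s 10 = enc_residue b"
    and le: "a \<le> p" "c \<le> p" "e \<le> 1" "b \<le> p"
  shows "runs B (update_sum p) s (p + 1 + 2 * p + 2 * 1 + 2 * p + 2 * p)
    (s(2 := [], 3 := [], 10 := [],
       1 := enc_residue (nat ((int a + (if e = 0 then int c else - int c) * int b) mod int p))))"
    (is "runs B _ s _ (s(2 := [], 3 := [], 10 := [], 1 := ?x))")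
proof -
  have "length ?x \<le> p" using p by (simp add: enc_residue_def nat_le_iff less_imp_le)
  then have 4: "runs B (pushes 1 ?x) (s(1 := [], 2 := [], 3 := [], 10 := [])) (p + 1)
      (s(2 := [], 3 := [], 10 := [], 1 := ?x))"
    by (intro runs_cong[OF runs_pushes]) (auto simp: fun_eq_iff enc_residue_def)
  show ?thesis unfolding update_sum_def
    by (rule runs_case_unary[where k = a], rule s(1)[unfolded enc_residue_def], rule le,
        rule runs_case_unary[where k = c], simp add: s enc_residue_def, rule le,
        rule runs_case_unary[where k = e], simp add: s enc_residue_def, rule le,
        rule runs_case_unary[where k = b], simp add: s enc_residue_def, rule le, rule 4)
qed

definition eval_term :: "nat \<Rightarrow> com" where
  "eval_term p = Seq (parse_int p) (Seq parse_graph (Seq (Ask 9 10) (Seq (clear 9) (update_sum p))))"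

definition eval_term_time :: "nat \<Rightarrow> nat \<Rightarrow> nat" where
  "eval_term_time p n = (3 + (1 + (Suc n * Suc (3 * p + 5) + 1))) + (((4 * n + 6) + ((n * (2 + 7) + 2) +
     (1 + ((n * ((n * (3 + 7) + 2) + 7) + 2) + ((2 * n + 1) + ((2 * n + 1) + (4 * (n + 1 + n * n) + 1)))))))
     + (Suc p + ((2 * n + 1) + (p + 1 + 2 * p + 2 * 1 + 2 * p + 2 * p))))"

text \<open>Register 11 is exempt from being empty because it holds the flag of the enclosing loop.
  All work registers are empty again at the end, so the step can be iterated.\<close>

lemma runs_eval_term:
  assumes p: "p > 0" and s: "s 0 = enc_int z @ enc_graph G @ xs" "s 1 = enc_residue a" "a < p"
    and e: "\<And>i. 2 \<le> i \<Longrightarrow> i \<noteq> 11 \<Longrightarrow> s i = []"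
    and G: "input_graph G" and L: "length (enc_int z @ enc_graph G) \<le> L"
  shows "runs (graph_problem p g) (eval_term p) s (eval_term_time p L)
    (s(0 := xs, 1 := enc_residue (nat ((int a + z * g G) mod int p))))"
proof -
  let ?B = "graph_problem p g"
  define b where "b = nat (g G mod int p)"
  define n where "n = card (verts G)"
  have b: "b \<le> p" "int b = g G mod int p" using p by (auto simp: b_def nat_le_iff less_imp_le)
  have n: "n \<le> L" using L by (simp add: length_enc_graph n_def)
  \<comment> \<open>The sign stack, empty or \<open>[True]\<close>, is read as the unary number 0 or
    1, so that \<open>case_unary\<close> also decides the sign.\<close>
  let ?c = "nat \<bar>z\<bar> mod p" and ?e = "if z < 0 then 1 else 0 :: nat"
  let ?s1 = "s(0 := enc_graph G @ xs, 2 := enc_residue ?c, 3 := enc_residue ?e)"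
  let ?s2 = "s(0 := xs, 2 := enc_residue ?c, 3 := enc_residue ?e, 9 := enc_graph G)"
  let ?s3 = "s(0 := xs, 2 := enc_residue ?c, 3 := enc_residue ?e, 9 := enc_graph G, 10 := enc_residue b)"
  let ?s4 = "s(0 := xs, 2 := enc_residue ?c, 3 := enc_residue ?e, 10 := enc_residue b)"
  have 1: "runs ?B (parse_int p) s (3 + (1 + (Suc L * Suc (3 * p + 5) + 1))) ?s1"
    by (rule runs_cong[OF runs_parse_int[where z = z and xs = "enc_graph G @ xs" and L = L]])
      (use p s e L in \<open>auto simp: enc_residue_def fun_eq_iff\<close>)
  have 2: "runs ?B parse_graph ?s1 ((4 * L + 6) + ((L * (2 + 7) + 2) + (1 + ((L * ((L * (3 + 7) + 2) + 7) + 2)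
     + ((2 * L + 1) + ((2 * L + 1) + (4 * (L + 1 + L * L) + 1))))))) ?s2"
    by (rule runs_cong[OF runs_parse_graph[of ?s1 G xs]])
      (use e in \<open>auto simp: fun_eq_iff intro!: add_mono mult_le_mono n[unfolded n_def]\<close>)
  have "(?s2 9, enc_residue b) \<in> ?B" using G by (auto simp: graph_problem_def b_def)
  then have 3: "runs ?B (Ask 9 10) ?s2 (Suc p) ?s3"
    by (intro runs_cong[OF runs_ask]) (use b in \<open>auto simp: enc_residue_def\<close>)
  have 4: "runs ?B (clear 9) ?s3 (2 * L + 1) ?s4"
    by (rule runs_cong[OF runs_clear]) (use e L in \<open>auto simp: fun_eq_iff\<close>)
  let ?x = "nat ((int a + (if ?e = 0 then int ?c else - int ?c) * int b) mod int p)"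
  have 5: "runs ?B (update_sum p) ?s4 (p + 1 + 2 * p + 2 * 1 + 2 * p + 2 * p)
     (?s4(2 := [], 3 := [], 10 := [], 1 := enc_residue ?x))"
    by (rule runs_update_sum) (use p s b in \<open>auto simp: less_imp_le\<close>)
  have "[(if ?e = 0 then int ?c else - int ?c) = z] (mod int p)"
    by (auto simp: cong_def zmod_int mod_minus_eq)
  moreover have "[int b = g G] (mod int p)" by (simp add: b cong_def)
  ultimately have "[int a + (if ?e = 0 then int ?c else - int ?c) * int b = int a + z * g G] (mod int p)"
    by (intro cong_add cong_mult cong_refl)
  then have x: "?x = nat ((int a + z * g G) mod int p)" unfolding cong_def by metis
  show ?thesis unfolding eval_term_def eval_term_time_def
    by (rule runs_cong[OF runs_seq[OF 1 runs_seq[OF 2 runs_seq[OF 3 runs_seq[OF 4 5]]]]])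
      (use e in \<open>auto simp: fun_eq_iff x\<close>)
qed

definition eval_quantum :: "nat \<Rightarrow> com" where
  "eval_quantum p = Seq (Push 11 True)
     (Seq (While 11 (Branch 0 Skip (Seq (Pop 0) (Pop 11)) (Seq (Pop 0) (eval_term p)))) (drain 1 0))"

text \<open>\<open>qhom\<close> is linear in its first argument, so \<open>Hbar\<close> enters only
  through a functional of ordinary graphs, and that is what the oracle computes.\<close>

lemma reducible_quantum:
  assumes p: "p > 0"
  shows "poly_turing_reducible (QHom_problem p Hbar)
    (graph_problem p (\<lambda>G. \<Sum>H \<in> Poly_Mapping.keys Hbar. Poly_Mapping.lookup Hbar H * int (hom G H)))"
proof -
  let ?g = "\<lambda>G. \<Sum>H \<in> Poly_Mapping.keys Hbar. Poly_Mapping.lookup Hbar H * int (hom G H)"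
  let ?B = "graph_problem p ?g"
  let ?T = "\<lambda>n. 1 + ((Suc n * Suc (eval_term_time p n + 2) + 1) + (4 * p + 1))"
  show ?thesis
  proof (rule poly_turing_reducible_runsI)
    show "poly_bounded ?T" unfolding eval_term_time_def by (intro poly_bounded_intros)
    fix w x assume "(w, x) \<in> QHom_problem p Hbar"
    then obtain Q Gs where Q: "w = enc_quantum Q Gs" "x = enc_residue (nat (qhom Q Hbar mod int p))"
      "\<forall>G \<in> Poly_Mapping.keys Q. input_graph G" "distinct Gs" "set Gs = Poly_Mapping.keys Q"
      by (auto simp: QHom_problem_def)
    let ?l = "Poly_Mapping.lookup Q"
    let ?t = "\<lambda>G. True # enc_int (?l G) @ enc_graph G"
    let ?w = "\<lambda>Gs. concat (map ?t Gs) @ [False]"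
    let ?S = "\<lambda>i. \<Sum>G \<leftarrow> take i Gs. ?l G * ?g G"
    let ?a = "\<lambda>i. nat (?S i mod int p)"
    let ?n = "length Gs"
    let ?s = "start []"
    let ?\<sigma> = "\<lambda>i. if i \<le> ?n then ?s(0 := ?w (drop i Gs), 1 := enc_residue (?a i), 11 := [True])
      else ?s(1 := enc_residue (?a ?n))"
    let ?c = "Branch 0 Skip (Seq (Pop 0) (Pop 11)) (Seq (Pop 0) (eval_term p))"
    have a: "?a i < p" for i using p by (simp add: nat_less_iff)
    have 1: "runs ?B (Push 11 True) (start [w]) 1 (?\<sigma> 0)"
      by (rule runs_cong[OF runs_push]) (auto simp: start_def fun_eq_iff Q(1) enc_quantum_def enc_residue_def)
    have len_term: "length (enc_int (?l G) @ enc_graph G) \<le> length w" if "G \<in> set Gs" for G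
    proof -
      have "length (?t G) \<le> sum_list (map (length \<circ> ?t) Gs)"
        using that by (intro member_le_sum_list) auto
      then show ?thesis by (simp add: Q(1) enc_quantum_def length_concat comp_def)
    qed
    \<comment> \<open>Each term contributes at least its leading \<open>True\<close>, which bounds
      the number of iterations by the input length.\<close>
    have "1 * ?n \<le> sum_list (map (length \<circ> ?t) Gs)"
      by (induction Gs) auto
    then have n: "?n \<le> length w" by (simp add: Q(1) enc_quantum_def length_concat comp_def)
    have 2: "runs ?B (While 11 ?c) (?\<sigma> 0) (Suc ?n * Suc (eval_term_time p (length w) + 2) + 1) (?\<sigma> (Suc ?n))"
    proof (rule runs_while)
      fix i assume i: "i < Suc ?n"
      have "runs ?B ?c (?\<sigma> i) (eval_term_time p (length w) + 2) (?\<sigma> (Suc i))"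
      proof (cases "i = ?n")
        case True
        have "runs ?B ?c (?\<sigma> i) (Suc (1 + 1)) (?\<sigma> (Suc i))"
          by (rule runs_cong[OF runs_branch_False[OF _ runs_seq[OF runs_pop runs_pop]]])
            (use True in \<open>auto simp: fun_eq_iff start_def\<close>)
        then show ?thesis by (rule runs_cong) (auto simp: eval_term_time_def)
      next
        case False
        with i have i': "i < ?n" by simp
        let ?G = "Gs ! i"
        have G: "?G \<in> set Gs" "input_graph ?G" using i' Q by auto
        have d: "?w (drop i Gs) = True # enc_int (?l ?G) @ enc_graph ?G @ ?w (drop (Suc i) Gs)"
          using i' by (simp flip: Cons_nth_drop_Suc)
        let ?s' = "?s(0 := enc_int (?l ?G) @ enc_graph ?G @ ?w (drop (Suc i) Gs), 1 := enc_residue (?a i), 11 := [True])"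
        have pop: "runs ?B (Pop 0) (?\<sigma> i) 1 ?s'"
          by (rule runs_cong[OF runs_pop]) (use i' d in \<open>auto simp: fun_eq_iff\<close>)
        have "[int (?a i) + ?l ?G * ?g ?G = ?S i + ?l ?G * ?g ?G] (mod int p)"
          using p by (simp add: cong_def mod_simps)
        also have "?S i + ?l ?G * ?g ?G = ?S (Suc i)"
          using i' by (simp add: take_Suc_conv_app_nth)
        finally have *: "nat ((int (?a i) + ?l ?G * ?g ?G) mod int p) = ?a (Suc i)"
          unfolding cong_def by metis
        have "runs ?B (eval_term p) ?s' (eval_term_time p (length w)) (?\<sigma> (Suc i))"
          by (rule runs_cong[OF runs_eval_term[where z = "?l ?G" and G = ?G and xs = "?w (drop (Suc i) Gs)"
                and a = "?a i" and L = "length w"]])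
            (use i' p a G(2) len_term[OF G(1)] * in \<open>auto simp: fun_eq_iff start_def\<close>)
        note step = runs_seq[OF pop this]
        show ?thesis
          by (rule runs_cong[OF runs_branch_True[OF _ step]]) (use d i' in auto)
      qed
      then show "?\<sigma> i 11 \<noteq> [] \<and> runs ?B ?c (?\<sigma> i) (eval_term_time p (length w) + 2) (?\<sigma> (Suc i))" using i by simp
    qed (simp add: start_def)
    have "qhom Q Hbar = (\<Sum>G \<in> Poly_Mapping.keys Q. ?l G * ?g G)"
      by (simp add: qhom_def sum_distrib_left mult.assoc)
    also have "\<dots> = ?S ?n" using Q(4,5) by (simp add: sum_list_distinct_conv_sum_set)
    finally have x: "x = enc_residue (?a ?n)" by (simp add: Q(2))
    have "?a ?n \<le> p" using a[of ?n] by simp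
    then have 3: "runs ?B (drain 1 0) (?\<sigma> (Suc ?n)) (4 * p + 1) (?s(0 := x))"
      by (intro runs_cong[OF runs_drain]) (auto simp: x enc_residue_def fun_eq_iff start_def)
    have "runs ?B (eval_quantum p) (start [w])
        (1 + ((Suc ?n * Suc (eval_term_time p (length w) + 2) + 1) + (4 * p + 1))) (?s(0 := x))"
      unfolding eval_quantum_def by (rule runs_seq[OF 1 runs_seq[OF 2 3]])
    then have "runs ?B (eval_quantum p) (start [w]) (?T (length w)) (?s(0 := x))"
      by (rule runs_cong) (use n in \<open>auto intro!: add_mono mult_le_mono1\<close>)
    then show "\<exists>s. runs ?B (eval_quantum p) (start [w]) (?T (length w)) s \<and> s 0 = x"
      by (intro exI[of _ "?s(0 := x)"] conjI) simp_all
  qed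
qed

section \<open>Counting homomorphisms, and separating graphs by their counts modulo
  \<open>p\<close>\<close>

section \<open>Homomorphisms\<close>

lemma finite_homs: "is_graph G \<Longrightarrow> is_graph H \<Longrightarrow> finite (homs G H)"
  by (rule finite_subset[of _ "verts G \<rightarrow>\<^sub>E verts H"]) (auto simp: homs_def is_graph_def intro: finite_PiE)

lemma input_graph_is_graph: "input_graph G \<Longrightarrow> is_graph G"
  by (simp add: input_graph_def)

lemma is_graph_edges: "is_graph G \<Longrightarrow> (u, v) \<in> edges G \<Longrightarrow> u \<in> verts G \<and> v \<in> verts G"
  by (auto simp: is_graph_def)

lemma homsI:
  assumes "\<sigma> \<in> verts G \<rightarrow>\<^sub>E verts H" "\<And>u v. (u, v) \<in> edges G \<Longrightarrow> (\<sigma> u, \<sigma> v) \<in> edges H"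
  shows "\<sigma> \<in> homs G H"
  using assms by (auto simp: homs_def)

lemma homsD:
  assumes "\<sigma> \<in> homs G H"
  shows "v \<in> verts G \<Longrightarrow> \<sigma> v \<in> verts H" "v \<notin> verts G \<Longrightarrow> \<sigma> v = undefined"
    "(u, v) \<in> edges G \<Longrightarrow> (\<sigma> u, \<sigma> v) \<in> edges H"
  using assms by (auto simp: homs_def PiE_def extensional_def)

text \<open>No edge joins the two blocks, so a homomorphism is an independent choice on each. As
  functions of \<open>H\<close>, the counts are thus multiplied by disjoint union.\<close>

lemma hom_graph_sum:
  assumes F: "input_graph F" and G: "input_graph G"
  shows "hom (graph_sum F G) H = hom F H * hom G H"
proof -
  define m where "m = card (verts F)"
  define n where "n = card (verts G)"
  have V: "verts F = {..<m}" "verts G = {..<n}" "verts (graph_sum F G) = {..<m + n}"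
    using input_graph_verts[OF F] input_graph_verts[OF G] by (auto simp: m_def n_def graph_sum_def)
  have E: "edges (graph_sum F G) = edges F \<union> (\<lambda>(i, j). (m + i, m + j)) ` edges G"
    by (simp add: graph_sum_def m_def)
  have EF: "i < m \<and> j < m" if "(i, j) \<in> edges F" for i j
    using input_graph_edges[OF F that] by (simp add: m_def)
  have EG: "i < n \<and> j < n" if "(i, j) \<in> edges G" for i j
    using input_graph_edges[OF G that] by (simp add: n_def)
  let ?f = "\<lambda>\<sigma>. (restrict \<sigma> {..<m}, \<lambda>i\<in>{..<n}. \<sigma> (m + i))"
  let ?g = "\<lambda>(\<alpha>, \<beta>). \<lambda>i\<in>{..<m + n}. if i < m then \<alpha> i else \<beta> (i - m)"
  have "bij_betw ?f (homs (graph_sum F G) H) (homs F H \<times> homs G H)"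
  proof (rule bij_betw_byWitness[where f' = ?g])
    show "\<forall>\<sigma> \<in> homs (graph_sum F G) H. ?g (?f \<sigma>) = \<sigma>"
    proof
      fix \<sigma> assume "\<sigma> \<in> homs (graph_sum F G) H"
      then have "\<sigma> i = undefined" if "\<not> i < m + n" for i
        using homsD(2)[of \<sigma> "graph_sum F G" H i] that by (simp add: V)
      then show "?g (?f \<sigma>) = \<sigma>" by (auto simp: fun_eq_iff)
    qed
    show "\<forall>x \<in> homs F H \<times> homs G H. ?f (?g x) = x"
      using homsD(2) by (fastforce simp: fun_eq_iff V)
    show "?f ` homs (graph_sum F G) H \<subseteq> homs F H \<times> homs G H"
    proof (rule image_subsetI, rule SigmaI)
      fix \<sigma> assume \<sigma>: "\<sigma> \<in> homs (graph_sum F G) H"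
      note h = homsD(1,3)[OF \<sigma>, unfolded V E]
      have "(\<sigma> (m + u), \<sigma> (m + v)) \<in> edges H" if "(u, v) \<in> edges G" for u v
        by (rule h(2)) (use that in force)
      with h EF EG
      show "restrict \<sigma> {..<m} \<in> homs F H" "(\<lambda>i\<in>{..<n}. \<sigma> (m + i)) \<in> homs G H"
        by (auto intro!: homsI simp: V)
    qed
    show "?g ` (homs F H \<times> homs G H) \<subseteq> homs (graph_sum F G) H"
    proof (clarsimp simp: image_subset_iff)
      fix \<alpha> \<beta> assume ab: "\<alpha> \<in> homs F H" "\<beta> \<in> homs G H"
      note h = homsD(1,3)[OF ab(1), unfolded V] homsD(1,3)[OF ab(2), unfolded V]
      show "(\<lambda>i\<in>{..<m + n}. if i < m then \<alpha> i else \<beta> (i - m)) \<in> homs (graph_sum F G) H"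
        using h EF EG by (intro homsI) (force simp: V E)+
    qed
  qed
  then show ?thesis unfolding Defs.hom_def
    by (simp add: bij_betw_same_card card_cartesian_product)
qed

text \<open>Non-edges may be mapped to edges, so this is weaker than an induced embedding; comparing
  numbers of edges will make up for it.\<close>

definition injs :: "'v graph \<Rightarrow> 'w graph \<Rightarrow> ('v \<Rightarrow> 'w) set" where
  "injs G H = {\<sigma> \<in> homs G H. inj_on \<sigma> (verts G)}"

lemma graph_iso_edges:
  "graph_iso \<phi> G H \<Longrightarrow> u \<in> verts G \<Longrightarrow> v \<in> verts G \<Longrightarrow> (\<phi> u, \<phi> v) \<in> edges H \<longleftrightarrow> (u, v) \<in> edges G"
  by (simp add: graph_iso_def)

lemma graph_iso_inv:
  assumes "graph_iso \<phi> G H"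
  shows "graph_iso (inv_into (verts G) \<phi>) H G"
proof -
  have b: "bij_betw \<phi> (verts G) (verts H)" using assms by (simp add: graph_iso_def)
  note i = bij_betw_inv_into[OF b]
  show ?thesis unfolding graph_iso_def
    using i bij_betwE[OF i] bij_betw_inv_into_right[OF b] graph_iso_edges[OF assms]
    by (metis (no_types, lifting))
qed

lemma graph_iso_precompose:
  assumes \<phi>: "graph_iso \<phi> G G'" and "is_graph G" "is_graph G'"
  shows "bij_betw (\<lambda>\<sigma>. restrict (\<sigma> \<circ> \<phi>) (verts G)) (homs G' H) (homs G H)"
    and "bij_betw (\<lambda>\<sigma>. restrict (\<sigma> \<circ> \<phi>) (verts G)) (injs G' H) (injs G H)"
proof -
  let ?\<psi> = "inv_into (verts G) \<phi>"
  have b: "bij_betw \<phi> (verts G) (verts G')" using \<phi> by (simp add: graph_iso_def)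
  note \<psi> = graph_iso_inv[OF \<phi>]
  have b': "bij_betw ?\<psi> (verts G') (verts G)" using \<psi> by (simp add: graph_iso_def)
  \<comment> \<open>Stated for arbitrary vertex types, since it is used both along
    \<open>\<phi>\<close> and along its inverse.\<close>
  have hom: "restrict (\<sigma> \<circ> \<chi>) (verts A) \<in> homs A H"
    if "graph_iso \<chi> A A'" "is_graph A" "\<sigma> \<in> homs A' H" for \<sigma> \<chi> and A :: "'x graph" and A' :: "'y graph"
  proof (rule homsI)
    have b: "bij_betw \<chi> (verts A) (verts A')" using that(1) by (simp add: graph_iso_def)
    then show "restrict (\<sigma> \<circ> \<chi>) (verts A) \<in> verts A \<rightarrow>\<^sub>E verts H"
      using homsD(1)[OF that(3)] bij_betwE[OF b] by auto
    fix u v assume uv: "(u, v) \<in> edges A"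
    then show "(restrict (\<sigma> \<circ> \<chi>) (verts A) u, restrict (\<sigma> \<circ> \<chi>) (verts A) v) \<in> edges H"
      using homsD(3)[OF that(3)] graph_iso_edges[OF that(1)] is_graph_edges[OF that(2) uv] by auto
  qed
  have inj: "inj_on (\<sigma> \<circ> \<chi>) A" if "bij_betw \<chi> A A'" "inj_on \<sigma> A'"
    for \<sigma> :: "'y \<Rightarrow> 'z" and \<chi> and A :: "'x set" and A'
    using that by (auto simp: bij_betw_def comp_inj_on)
  have 1: "restrict (restrict (\<sigma> \<circ> \<phi>) (verts G) \<circ> ?\<psi>) (verts G') = \<sigma>" if "\<sigma> \<in> homs G' H" for \<sigma>
    using homsD(2)[OF that] bij_betwE[OF b'] bij_betw_inv_into_right[OF b] by (auto simp: fun_eq_iff)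
  have 2: "restrict (restrict (\<sigma> \<circ> ?\<psi>) (verts G') \<circ> \<phi>) (verts G) = \<sigma>" if "\<sigma> \<in> homs G H" for \<sigma>
    using homsD(2)[OF that] bij_betwE[OF b] bij_betw_inv_into_left[OF b] by (auto simp: fun_eq_iff)
  show "bij_betw (\<lambda>\<sigma>. restrict (\<sigma> \<circ> \<phi>) (verts G)) (homs G' H) (homs G H)"
    by (rule bij_betw_byWitness[where f' = "\<lambda>\<sigma>. restrict (\<sigma> \<circ> ?\<psi>) (verts G')"])
      (auto simp: 1 2 hom[OF \<phi> assms(2)] hom[OF \<psi> assms(3)])
  show "bij_betw (\<lambda>\<sigma>. restrict (\<sigma> \<circ> \<phi>) (verts G)) (injs G' H) (injs G H)"
    by (rule bij_betw_byWitness[where f' = "\<lambda>\<sigma>. restrict (\<sigma> \<circ> ?\<psi>) (verts G')"])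
      (auto simp: injs_def 1 2 hom[OF \<phi> assms(2)] hom[OF \<psi> assms(3)] inj[OF b] inj[OF b'])
qed

text \<open>Constituents have vertices of an arbitrary type and quotients have gaps in their vertex
  sets; both are replaced by copies that are legal inputs.\<close>

lemma input_copy:
  assumes "is_graph H"
  obtains H0 \<phi> where "input_graph H0" "graph_iso \<phi> H0 H"
proof -
  obtain f where f: "bij_betw f (verts H) {0..<card (verts H)}"
    using assms ex_bij_betw_finite_nat by (auto simp: is_graph_def)
  let ?H0 = "\<lparr>verts = {..<card (verts H)}, edges = (\<lambda>(u, v). (f u, f v)) ` edges H\<rparr>"
  have f': "bij_betw f (verts H) (verts ?H0)" using f by (simp add: atLeast0LessThan)
  have "graph_iso f H ?H0"
    unfolding graph_iso_def
  proof (intro conjI ballI f')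
    fix u v assume uv: "u \<in> verts H" "v \<in> verts H"
    have inj: "inj_on f (verts H)" using f by (simp add: bij_betw_def)
    show "(u, v) \<in> edges H \<longleftrightarrow> (f u, f v) \<in> edges ?H0"
    proof
      assume "(f u, f v) \<in> edges ?H0"
      then obtain u' v' where e: "(u', v') \<in> edges H" "f u = f u'" "f v = f v'" by auto
      with is_graph_edges[OF assms e(1)] uv inj show "(u, v) \<in> edges H"
        by (metis inj_onD)
    qed force
  qed
  then have "graph_iso (inv_into (verts H) f) ?H0 H" by (rule graph_iso_inv)
  moreover have "input_graph ?H0" unfolding input_graph_def is_graph_def
    using assms bij_betwE[OF f'] is_graph_edges[OF assms] by (auto simp: is_graph_def sym_def)
  ultimately show thesis by (rule that[rotated])
qed

section \<open>Counting by kernels\<close>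

text \<open>The partition of \<open>V\<close> into fibres of \<open>\<sigma>\<close> is represented
  by the map to the least element of each block, which makes the representation canonical.\<close>

definition kernel_of :: "nat set \<Rightarrow> (nat \<Rightarrow> 'w) \<Rightarrow> nat \<Rightarrow> nat" where
  "kernel_of V \<sigma> = (\<lambda>v\<in>V. Min {u \<in> V. \<sigma> u = \<sigma> v})"

text \<open>The conditions force \<open>\<kappa> v\<close> to be the least element of its block, so
  these maps correspond to the partitions of \<open>V\<close>.\<close>

definition kernels :: "nat set \<Rightarrow> (nat \<Rightarrow> nat) set" where
  "kernels V = {\<kappa> \<in> V \<rightarrow>\<^sub>E V. \<forall>v \<in> V. \<kappa> (\<kappa> v) = \<kappa> v \<and> \<kappa> v \<le> v}"

text \<open>The blocks are represented by their least elements, and edges inside a block become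
  loops.\<close>

definition quotient :: "(nat \<Rightarrow> nat) \<Rightarrow> nat graph \<Rightarrow> nat graph" where
  "quotient \<kappa> F = \<lparr>verts = \<kappa> ` verts F, edges = (\<lambda>(u, v). (\<kappa> u, \<kappa> v)) ` edges F\<rparr>"

lemma kernel_of_props:
  assumes "finite V" "v \<in> V"
  shows "kernel_of V \<sigma> v \<in> V" "\<sigma> (kernel_of V \<sigma> v) = \<sigma> v" "kernel_of V \<sigma> v \<le> v"
proof -
  let ?S = "{u \<in> V. \<sigma> u = \<sigma> v}"
  have "finite ?S" "v \<in> ?S" using assms by auto
  then have "Min ?S \<in> ?S" "Min ?S \<le> v" using Min_in[of ?S] Min_le[of ?S v] by auto
  then show "kernel_of V \<sigma> v \<in> V" "\<sigma> (kernel_of V \<sigma> v) = \<sigma> v" "kernel_of V \<sigma> v \<le> v"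
    using assms(2) by (auto simp: kernel_of_def)
qed

lemma kernel_of_eq: "v \<in> V \<Longrightarrow> u \<in> V \<Longrightarrow> \<sigma> u = \<sigma> v \<Longrightarrow> kernel_of V \<sigma> u = kernel_of V \<sigma> v"
  by (simp add: kernel_of_def)

lemma kernel_of_in_kernels:
  assumes "finite V"
  shows "kernel_of V \<sigma> \<in> kernels V"
proof -
  have "kernel_of V \<sigma> (kernel_of V \<sigma> v) = kernel_of V \<sigma> v" if "v \<in> V" for v
    using kernel_of_props[OF assms that] that by (intro kernel_of_eq)
  moreover have "kernel_of V \<sigma> \<in> V \<rightarrow>\<^sub>E V"
    using kernel_of_props(1)[OF assms] by (auto simp: kernel_of_def PiE_def)
  ultimately show ?thesis
    using kernel_of_props(3)[OF assms] by (auto simp: kernels_def)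
qed

lemma finite_kernels: "finite V \<Longrightarrow> finite (kernels V)"
  by (rule finite_subset[of _ "V \<rightarrow>\<^sub>E V"]) (auto simp: kernels_def intro: finite_PiE)

lemma is_graph_quotient:
  assumes "is_graph F" "\<kappa> \<in> kernels (verts F)"
  shows "is_graph (quotient \<kappa> F)"
  using assms is_graph_edges[OF assms(1)] by (auto simp: is_graph_def quotient_def sym_def)

text \<open>A homomorphism factors through the quotient by its kernel, and the induced map is
  injective. Conversely, \<open>\<tau> \<circ> \<kappa>\<close> has kernel \<open>\<kappa>\<close>
  because \<open>\<tau>\<close> is injective.\<close>

lemma card_homs_with_kernel:
  assumes F: "is_graph F" and \<kappa>: "\<kappa> \<in> kernels (verts F)"
  shows "card {\<sigma> \<in> homs F H. kernel_of (verts F) \<sigma> = \<kappa>} = card (injs (quotient \<kappa> F) H)"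
proof -
  let ?V = "verts F"
  have fin: "finite ?V" using F by (simp add: is_graph_def)
  have K: "\<kappa> v \<in> ?V" "\<kappa> (\<kappa> v) = \<kappa> v" "\<kappa> v \<le> v" if "v \<in> ?V" for v
    using \<kappa> that by (auto simp: kernels_def)
  note E = is_graph_edges[OF F]
  let ?f = "\<lambda>\<sigma>. restrict \<sigma> (\<kappa> ` ?V)" and ?g = "\<lambda>\<tau>. restrict (\<tau> \<circ> \<kappa>) ?V"
  let ?A = "{\<sigma> \<in> homs F H. kernel_of ?V \<sigma> = \<kappa>}"
  have "bij_betw ?f ?A (injs (quotient \<kappa> F) H)"
  proof (rule bij_betw_byWitness[where f' = ?g])
    have s: "\<sigma> (\<kappa> v) = \<sigma> v" if "\<sigma> \<in> ?A" "v \<in> ?V" for \<sigma> v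
      using kernel_of_props(2)[OF fin that(2), of \<sigma>] that by auto
    show "\<forall>\<sigma> \<in> ?A. ?g (?f \<sigma>) = \<sigma>"
      using s homsD(2) by (fastforce simp: fun_eq_iff)
    show "\<forall>\<tau> \<in> injs (quotient \<kappa> F) H. ?f (?g \<tau>) = \<tau>"
    proof
      fix \<tau> assume "\<tau> \<in> injs (quotient \<kappa> F) H"
      then have "\<tau> v = undefined" if "v \<notin> \<kappa> ` ?V" for v
        using homsD(2) that by (fastforce simp: injs_def quotient_def)
      moreover have "\<kappa> v \<in> ?V \<and> \<kappa> (\<kappa> v) = \<kappa> v" if "v \<in> ?V" for v using K that by simp
      ultimately show "?f (?g \<tau>) = \<tau>" by (auto simp: restrict_def fun_eq_iff)
    qed
    show "?f ` ?A \<subseteq> injs (quotient \<kappa> F) H"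
    proof (rule image_subsetI)
      fix \<sigma> assume \<sigma>: "\<sigma> \<in> ?A"
      then have h: "\<sigma> \<in> homs F H" and k: "kernel_of ?V \<sigma> = \<kappa>" by auto
      have "?f \<sigma> \<in> homs (quotient \<kappa> F) H"
      proof (rule homsI)
        show "?f \<sigma> \<in> verts (quotient \<kappa> F) \<rightarrow>\<^sub>E verts H"
          using homsD(1)[OF h] K(1) by (auto simp: quotient_def)
        fix x y assume "(x, y) \<in> edges (quotient \<kappa> F)"
        then obtain u v where e: "(u, v) \<in> edges F" "x = \<kappa> u" "y = \<kappa> v" by (auto simp: quotient_def)
        with E[OF e(1)] homsD(3)[OF h e(1)] s[OF \<sigma>] show "(?f \<sigma> x, ?f \<sigma> y) \<in> edges H" by simp
      qed
      moreover have "inj_on (?f \<sigma>) (\<kappa> ` ?V)"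
      proof (rule inj_onI, clarsimp)
        fix u v assume uv: "u \<in> ?V" "v \<in> ?V" "\<sigma> (\<kappa> u) = \<sigma> (\<kappa> v)"
        then show "\<kappa> u = \<kappa> v" using kernel_of_eq[of v ?V u \<sigma>] s[OF \<sigma>] k by simp
      qed
      ultimately show "?f \<sigma> \<in> injs (quotient \<kappa> F) H" by (simp add: injs_def quotient_def)
    qed
    show "?g ` injs (quotient \<kappa> F) H \<subseteq> ?A"
    proof (rule image_subsetI)
      fix \<tau> assume \<tau>: "\<tau> \<in> injs (quotient \<kappa> F) H"
      then have h: "\<tau> \<in> homs (quotient \<kappa> F) H" and inj: "inj_on \<tau> (\<kappa> ` ?V)"
        by (auto simp: injs_def quotient_def)
      have "?g \<tau> \<in> homs F H"
      proof (rule homsI)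
        show "?g \<tau> \<in> verts F \<rightarrow>\<^sub>E verts H"
          using homsD(1)[OF h] by (auto simp: quotient_def)
        fix u v assume e: "(u, v) \<in> edges F"
        then have "(\<kappa> u, \<kappa> v) \<in> edges (quotient \<kappa> F)" by (force simp: quotient_def)
        with E[OF e] homsD(3)[OF h this] show "(?g \<tau> u, ?g \<tau> v) \<in> edges H" by simp
      qed
      moreover have "kernel_of ?V (?g \<tau>) v = \<kappa> v" for v
      proof (cases "v \<in> ?V")
        case True
        have "{u \<in> ?V. ?g \<tau> u = ?g \<tau> v} = {u \<in> ?V. \<kappa> u = \<kappa> v}"
          using True inj by (auto simp: inj_on_def)
        moreover have "Min {u \<in> ?V. \<kappa> u = \<kappa> v} = \<kappa> v"
        proof (rule Min_eqI)
          show "\<kappa> v \<le> u" if "u \<in> {u \<in> ?V. \<kappa> u = \<kappa> v}" for u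
            using that K(3)[of u] by auto
        qed (use fin K True in auto)
        ultimately show ?thesis using True by (simp add: kernel_of_def)
      next
        case False
        then show ?thesis using \<kappa> by (auto simp: kernel_of_def kernels_def PiE_def extensional_def)
      qed
      ultimately show "?g \<tau> \<in> ?A" by (simp add: fun_eq_iff)
    qed
  qed
  then show ?thesis by (rule bij_betw_same_card)
qed

lemma hom_eq_sum_injs:
  assumes F: "is_graph F" and H: "is_graph H"
  shows "hom F H = (\<Sum>\<kappa> \<in> kernels (verts F). card (injs (quotient \<kappa> F) H))"
proof -
  have fin: "finite (verts F)" using F by (simp add: is_graph_def)
  have "hom F H = (\<Sum>\<kappa> \<in> kernels (verts F). card {\<sigma> \<in> homs F H. kernel_of (verts F) \<sigma> = \<kappa>})"
    unfolding Defs.hom_def card_eq_sum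
    by (rule sum.group[symmetric]) (use finite_homs[OF F H] finite_kernels[OF fin] kernel_of_in_kernels[OF fin] in auto)
  then show ?thesis by (simp add: card_homs_with_kernel[OF F])
qed

text \<open>The trivial kernel contributes the injective maps from \<open>F\<close> itself, every
  other one those from a graph with fewer vertices. Induction on the number of vertices therefore
  yields the claim by subtraction. It covers all graphs on natural numbers, as quotients need not be
  input graphs.\<close>

lemma cong_injs:
  assumes hom: "\<And>F. input_graph F \<Longrightarrow> [int (hom F H) = int (hom F H')] (mod q)"
    and H: "is_graph H" "is_graph H'" and F: "is_graph (F :: nat graph)"
  shows "[int (card (injs F H)) = int (card (injs F H'))] (mod q)"
  using F
proof (induction "card (verts F)" arbitrary: F rule: less_induct)
  case less
  let ?V = "verts F"
  have fin: "finite ?V" using less.prems by (simp add: is_graph_def)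
  obtain F0 \<phi> where F0: "input_graph F0" "graph_iso \<phi> F0 F" using input_copy[OF less.prems] .
  have hom_F0: "hom F0 K = hom F K" for K :: "'x graph"
    unfolding Defs.hom_def
    by (rule bij_betw_same_card[OF graph_iso_precompose(1)[OF F0(2) input_graph_is_graph[OF F0(1)] less.prems], symmetric])
  have homF: "[int (hom F H) = int (hom F H')] (mod q)"
    using hom[OF F0(1)] hom_F0[of H] hom_F0[of H'] by simp
  let ?id = "restrict id ?V" and ?K = "kernels ?V"
  have id: "?id \<in> ?K" by (auto simp: kernels_def)
  have q: "quotient ?id F = F"
  proof -
    have "(\<lambda>(u, v). (?id u, ?id v)) ` edges F = id ` edges F"
      using is_graph_edges[OF less.prems] by (intro image_cong) auto
    then show ?thesis by (simp add: quotient_def)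
  qed
  have split: "int (hom F K) = int (card (injs F K)) + (\<Sum>\<kappa> \<in> ?K - {?id}. int (card (injs (quotient \<kappa> F) K)))"
    if "is_graph K" for K :: "'x graph"
    using hom_eq_sum_injs[OF less.prems that] sum.remove[OF finite_kernels[OF fin] id, of "\<lambda>\<kappa>. card (injs (quotient \<kappa> F) K)"] q
    by simp
  have "[(\<Sum>\<kappa> \<in> ?K - {?id}. int (card (injs (quotient \<kappa> F) H))) =
      (\<Sum>\<kappa> \<in> ?K - {?id}. int (card (injs (quotient \<kappa> F) H')))] (mod q)"
  proof (rule cong_sum)
    fix \<kappa> assume \<kappa>: "\<kappa> \<in> ?K - {?id}"
    then have "\<kappa> ` ?V \<subseteq> ?V" by (auto simp: kernels_def)
    \<comment> \<open>An idempotent map onto \<open>?V\<close> is the identity, so every other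
      kernel loses a vertex.\<close>
    moreover have "\<kappa> ` ?V \<noteq> ?V"
    proof
      assume "\<kappa> ` ?V = ?V"
      have "\<kappa> v = v" if "v \<in> ?V" for v
      proof -
        from that \<open>\<kappa> ` ?V = ?V\<close> obtain u where "u \<in> ?V" "v = \<kappa> u" by blast
        then show ?thesis using \<kappa> by (simp add: kernels_def)
      qed
      then have "\<kappa> = ?id" using \<kappa> by (auto simp: kernels_def PiE_def extensional_def fun_eq_iff)
      with \<kappa> show False by simp
    qed
    ultimately have "card (verts (quotient \<kappa> F)) < card ?V"
      unfolding quotient_def using fin by (auto intro: psubset_card_mono)
    then show "[int (card (injs (quotient \<kappa> F) H)) = int (card (injs (quotient \<kappa> F) H'))] (mod q)"
      using less.hyps is_graph_quotient[OF less.prems] \<kappa> by blast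
  qed
  from cong_diff[OF homF this] show ?case using split[OF H(1)] split[OF H(2)] by simp
qed

section \<open>Separating order-reduced graphs\<close>

text \<open>The induced map on edges is injective as well; the bound on the number of edges makes it
  onto, and hence edges are reflected. With \<open>G = H\<close> this identifies
  \<open>injs H H\<close> with the automorphisms.\<close>

lemma graph_iso_injs:
  assumes G: "is_graph G" and H: "is_graph H" and \<sigma>: "\<sigma> \<in> injs G H"
    and card: "card (verts H) \<le> card (verts G)" "card (edges H) \<le> card (edges G)"
  shows "graph_iso \<sigma> G H"
proof -
  have h: "\<sigma> \<in> homs G H" and inj: "inj_on \<sigma> (verts G)" using \<sigma> by (auto simp: injs_def)
  have fin: "finite (verts H)" "finite (edges H)"
    using H finite_subset[of "edges H" "verts H \<times> verts H"] by (auto simp: is_graph_def)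
  have V: "\<sigma> ` verts G = verts H"
    using homsD(1)[OF h] inj card(1) by (intro card_seteq fin) (auto simp: card_image)
  let ?e = "map_prod \<sigma> \<sigma>"
  have "inj_on ?e (edges G)"
    using inj by (rule inj_on_subset[OF map_prod_inj_on[of \<sigma> "verts G" \<sigma> "verts G"]])
      (use G inj in \<open>auto simp: is_graph_def\<close>)
  then have E: "?e ` edges G = edges H"
    using homsD(3)[OF h] card(2) by (intro card_seteq fin) (auto simp: card_image)
  show ?thesis unfolding graph_iso_def
  proof (intro conjI ballI)
    show "bij_betw \<sigma> (verts G) (verts H)" using inj V by (simp add: bij_betw_def)
    fix u v assume uv: "u \<in> verts G" "v \<in> verts G"
    show "(u, v) \<in> edges G \<longleftrightarrow> (\<sigma> u, \<sigma> v) \<in> edges H"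
    proof
      assume "(\<sigma> u, \<sigma> v) \<in> edges H"
      then have "(\<sigma> u, \<sigma> v) \<in> ?e ` edges G" by (simp add: E)
      then obtain u' v' where e: "(u', v') \<in> edges G" "\<sigma> u = \<sigma> u'" "\<sigma> v = \<sigma> v'" by auto
      with is_graph_edges[OF G e(1)] uv inj show "(u, v) \<in> edges G" by (metis inj_onD)
    qed (rule homsD(3)[OF h])
  qed
qed

text \<open>For embeddings in both directions this supplies the cardinality hypotheses of
  \<open>graph_iso_injs\<close>.\<close>

lemma injs_card_le:
  assumes G: "is_graph G" and H: "is_graph H" and \<sigma>: "\<sigma> \<in> injs G H"
  shows "card (verts G) \<le> card (verts H)" "card (edges G) \<le> card (edges H)"
proof -
  have h: "\<sigma> \<in> homs G H" and inj: "inj_on \<sigma> (verts G)" using \<sigma> by (auto simp: injs_def)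
  have fin: "finite (verts H)" "finite (edges H)"
    using H finite_subset[of "edges H" "verts H \<times> verts H"] by (auto simp: is_graph_def)
  show "card (verts G) \<le> card (verts H)"
    using homsD(1)[OF h] by (intro card_inj_on_le[OF inj _ fin(1)]) auto
  have "inj_on (map_prod \<sigma> \<sigma>) (edges G)"
    using inj by (rule inj_on_subset[OF map_prod_inj_on[of \<sigma> "verts G" \<sigma> "verts G"]])
      (use G inj in \<open>auto simp: is_graph_def\<close>)
  then show "card (edges G) \<le> card (edges H)"
    using homsD(3)[OF h] by (intro card_inj_on_le[OF _ _ fin(2)]) auto
qed

lemma not_dvd_card_injs:
  assumes p: "prime p" and H: "is_graph H" and red: "order_reduced p H"
  shows "\<not> p dvd card (injs H H)"
proof
  assume dvd: "p dvd card (injs H H)"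
  let ?V = "verts H"
  \<comment> \<open>Group elements are extensional maps, so that equality in the group is agreement
    on the vertices, as in \<open>is_id_on\<close>.\<close>
  define A where "A = \<lparr>carrier = injs H H, monoid.mult = compose ?V, one = restrict id ?V\<rparr>"
  have iso: "graph_iso \<sigma> H H" if "\<sigma> \<in> injs H H" for \<sigma>
    using graph_iso_injs[OF H H that] by simp
  have bij: "bij_betw \<sigma> ?V ?V" if "\<sigma> \<in> injs H H" for \<sigma>
    using iso[OF that] by (simp add: graph_iso_def)
  have ext: "\<sigma> \<in> extensional ?V" if "\<sigma> \<in> injs H H" for \<sigma>
    using that by (auto simp: injs_def homs_def PiE_def)
  have iso_in: "restrict \<sigma> ?V \<in> injs H H" if "graph_iso \<sigma> H H" for \<sigma>
  proof -
    have b: "bij_betw \<sigma> ?V ?V" using that by (simp add: graph_iso_def)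
    have "restrict \<sigma> ?V \<in> homs H H"
      using bij_betwE[OF b] graph_iso_edges[OF that] is_graph_edges[OF H] by (intro homsI) auto
    then show ?thesis using b by (simp add: injs_def bij_betw_def)
  qed
  have comp: "compose ?V \<sigma> \<tau> \<in> injs H H" if "\<sigma> \<in> injs H H" "\<tau> \<in> injs H H" for \<sigma> \<tau>
  proof -
    have "graph_iso (\<sigma> \<circ> \<tau>) H H"
      using bij_betw_trans[OF bij[OF that(2)] bij[OF that(1)]] bij_betwE[OF bij[OF that(2)]]
        graph_iso_edges[OF iso[OF that(1)]] graph_iso_edges[OF iso[OF that(2)]]
      by (simp add: graph_iso_def)
    from iso_in[OF this] show ?thesis by (simp add: compose_def comp_def restrict_def)
  qed
  have one: "restrict id ?V \<in> injs H H" by (rule iso_in) (simp add: graph_iso_def)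
  interpret A: group A
  proof (rule groupI)
    fix x y z assume "x \<in> carrier A" "y \<in> carrier A" "z \<in> carrier A"
    then show "x \<otimes>\<^bsub>A\<^esub> y \<otimes>\<^bsub>A\<^esub> z = x \<otimes>\<^bsub>A\<^esub> (y \<otimes>\<^bsub>A\<^esub> z)"
      using bij_betwE[OF bij] by (auto simp: A_def compose_def fun_eq_iff)
  next
    fix x assume x: "x \<in> carrier A"
    then have x': "x \<in> injs H H" by (simp add: A_def)
    show "\<one>\<^bsub>A\<^esub> \<otimes>\<^bsub>A\<^esub> x = x"
      using bij_betwE[OF bij[OF x']] ext[OF x'] by (auto simp: A_def compose_def fun_eq_iff extensional_def)
    show "\<exists>y \<in> carrier A. y \<otimes>\<^bsub>A\<^esub> x = \<one>\<^bsub>A\<^esub>"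
    proof
      show "restrict (inv_into ?V x) ?V \<in> carrier A"
        using iso_in[OF graph_iso_inv[OF iso[OF x']]] by (simp add: A_def)
      show "restrict (inv_into ?V x) ?V \<otimes>\<^bsub>A\<^esub> x = \<one>\<^bsub>A\<^esub>"
        using bij_betwE[OF bij[OF x']] bij_betw_inv_into_left[OF bij[OF x']]
        by (auto simp: A_def compose_def fun_eq_iff)
    qed
  qed (use comp one in \<open>auto simp: A_def\<close>)
  have finA: "finite (carrier A)"
    using finite_homs[OF H H] by (auto simp: A_def injs_def)
  obtain m where "order A = p ^ 1 * m"
    using dvd by (auto simp: order_def A_def elim: dvdE)
  \<comment> \<open>Cauchy's theorem arises as Sylow's theorem for exponent 1, where
    \<open>m\<close> may be divisible by \<open>p\<close> again. Any element of \<open>K\<close>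
    other than the identity has order \<open>p\<close>.\<close>
  then obtain K where K: "subgroup K A" "card K = p"
    using sylow_thm[OF p A.is_group _ finA, of 1 m] by auto
  have "card K > 1" using K(2) prime_gt_1_nat[OF p] by simp
  then obtain x where x: "x \<in> K" "x \<noteq> \<one>\<^bsub>A\<^esub>"
    by (metis One_nat_def card.empty card.insert card_mono empty_iff finite.emptyI finite.insertI insertI1
        linorder_not_le not_one_less_zero subsetI le_refl)
  have xA: "x \<in> carrier A" using x(1) subgroup.subset[OF K(1)] by blast
  then have x': "x \<in> injs H H" by (simp add: A_def)
  interpret K: group "A\<lparr>carrier := K\<rparr>" by (rule A.subgroup_imp_group[OF K(1)])
  have "x [^]\<^bsub>A\<lparr>carrier := K\<rparr>\<^esub> order (A\<lparr>carrier := K\<rparr>) = \<one>\<^bsub>A\<lparr>carrier := K\<rparr>\<^esub>"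
    using x(1) by (intro K.pow_order_eq_1) simp
  then have xp: "x [^]\<^bsub>A\<^esub> p = \<one>\<^bsub>A\<^esub>"
    using K(2) A.nat_pow_consistent[of x p K] by (simp add: order_def)
  have pow: "x [^]\<^bsub>A\<^esub> k = restrict (x ^^ k) ?V" for k :: nat
  proof (induction k)
    case 0
    then show ?case by (simp add: A_def id_def)
  next
    case (Suc k)
    have "x [^]\<^bsub>A\<^esub> Suc k = compose ?V (restrict (x ^^ k) ?V) x"
      unfolding nat_pow_Suc Suc by (simp add: A_def)
    also have "\<dots> = restrict (x ^^ Suc k) ?V"
      using bij_betwE[OF bij[OF x']] by (auto simp: compose_def fun_eq_iff funpow_swap1)
    finally show ?case .
  qed
  have one_iff: "x [^]\<^bsub>A\<^esub> k = \<one>\<^bsub>A\<^esub> \<longleftrightarrow> is_id_on ?V (x ^^ k)" for k :: nat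
    unfolding pow by (auto simp: A_def is_id_on_def fun_eq_iff restrict_def)
  have "has_order x H p"
    unfolding has_order_def
  proof (intro conjI allI impI)
    show "\<not> is_id_on ?V x"
      using x(2) one_iff[of 1] xA by (simp add: A.nat_pow_eone)
    show "0 < p" using p by (simp add: prime_gt_0_nat)
    show "is_id_on ?V (x ^^ p)" using xp one_iff by simp
    fix j assume j: "0 < j \<and> j < p"
    show "\<not> is_id_on ?V (x ^^ j)"
    proof
      assume "is_id_on ?V (x ^^ j)"
      then have "A.ord x dvd j" "A.ord x dvd p"
        using xp one_iff xA by (auto simp: A.pow_eq_id[symmetric])
      \<comment> \<open>The order divides the prime \<open>p\<close> and is at most
        \<open>j < p\<close>.\<close>
      then have "A.ord x = 1" using p j by (metis nat_dvd_not_less prime_nat_iff)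
      then show False using A.pow_ord_eq_1[OF xA] x(2) xA by simp
    qed
  qed
  then show False using red iso[OF x'] by (auto simp: order_reduced_def automorphism_def)
qed

lemma separating_graph:
  fixes H H' :: "'v graph"
  assumes p: "prime p" and H: "is_graph H" "is_graph H'" and red: "order_reduced p H" "order_reduced p H'"
    and ne: "\<not> isomorphic H H'"
  obtains F where "input_graph F" "\<not> [int (hom F H) = int (hom F H')] (mod int p)"
proof -
  \<comment> \<open>The number of injective endomorphisms of \<open>A\<close> is nonzero modulo
    \<open>p\<close>; the congruence of injective counts carries this over to maps from
    \<open>A\<close> to \<open>B\<close>, so one exists.\<close>
  have emb: "injs A B \<noteq> {}"
    if c: "\<And>F. input_graph F \<Longrightarrow> [int (hom F A) = int (hom F B)] (mod int p)"
      and A: "is_graph A" and B: "is_graph B" and red: "order_reduced p A" for A B :: "'x graph"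
  proof
    assume e: "injs A B = {}"
    obtain A0 \<phi> where A0: "input_graph A0" "graph_iso \<phi> A0 A" using input_copy[OF A] .
    note card = bij_betw_same_card[OF graph_iso_precompose(2)[OF A0(2) input_graph_is_graph[OF A0(1)] A]]
    have "[int (card (injs A0 A)) = int (card (injs A0 B))] (mod int p)"
      by (rule cong_injs) (use c A B input_graph_is_graph[OF A0(1)] in auto)
    then have "p dvd card (injs A A)"
      using card[of A] card[of B] e by (simp add: cong_0_iff)
    then show False using not_dvd_card_injs[OF p A red] by contradiction
  qed
  show thesis
  proof (rule ccontr)
    assume "\<not> thesis"
    with that have c: "[int (hom F H) = int (hom F H')] (mod int p)" if "input_graph F" for F
      using that by blast
    obtain \<sigma> \<tau> where s: "\<sigma> \<in> injs H H'" "\<tau> \<in> injs H' H"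
      using emb[OF c H red(1)] emb[OF cong_sym[OF c] H(2,1) red(2)] by blast
    have "graph_iso \<sigma> H H'"
      using injs_card_le[OF H(2,1) s(2)] by (intro graph_iso_injs[OF H s(1)])
    with ne show False by (auto simp: isomorphic_def)
  qed
qed

lemma mod_prime_inverse:
  assumes "prime p" "\<not> int p dvd c"
  obtains d where "[c * d = 1] (mod int p)"
proof -
  have "coprime c (int p)"
    using assms prime_imp_coprime[of "int p" c] by (simp add: coprime_commute)
  then show thesis using cong_solve_coprime_int that by blast
qed

text \<open>One factor is multiplied on for each element of \<open>J\<close>. Products of
  functionals are realised by disjoint unions, so the result is again a linear combination of
  counts.\<close>

lemma indicator_combination:
  fixes H :: "'v graph" and J :: "'v graph set"
  assumes p: "prime p" and fin: "finite J"
    and H: "is_graph H" "order_reduced p H"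
    and J: "\<And>K. K \<in> J \<Longrightarrow> is_graph K \<and> order_reduced p K \<and> \<not> isomorphic H K"
  shows "\<exists>xs. (\<forall>(c, F) \<in> set xs. input_graph F) \<and>
    [(\<Sum>(c, F) \<leftarrow> xs. c * int (hom F H)) = 1] (mod int p) \<and>
    (\<forall>K \<in> J. [(\<Sum>(c, F) \<leftarrow> xs. c * int (hom F K)) = 0] (mod int p))"
  using fin J
proof (induction J)
  case empty
  \<comment> \<open>The empty graph has the empty map as its only homomorphism and so realises the
    empty product, the constant 1.\<close>
  have "input_graph \<lparr>verts = {}, edges = {}\<rparr>"
    by (auto simp: input_graph_def is_graph_def sym_def intro: exI[of _ 0])
  moreover have "homs \<lparr>verts = {}, edges = {}\<rparr> H = {\<lambda>_ :: nat. undefined}" by (auto simp: homs_def)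
  ultimately show ?case
    by (intro exI[of _ "[(1, \<lparr>verts = {}, edges = {}\<rparr>)]"]) (simp add: Defs.hom_def)
next
  case (insert H' J)
  then obtain xs where xs: "\<forall>(c, F) \<in> set xs. input_graph F"
    "[(\<Sum>(c, F) \<leftarrow> xs. c * int (hom F H)) = 1] (mod int p)"
    "\<And>K. K \<in> J \<Longrightarrow> [(\<Sum>(c, F) \<leftarrow> xs. c * int (hom F K)) = 0] (mod int p)"
    by auto
  obtain F where F: "input_graph F" "\<not> [int (hom F H) = int (hom F H')] (mod int p)"
    using separating_graph[OF p H(1) _ H(2), of H'] insert.prems[of H'] by auto
  then obtain d where d: "[(int (hom F H) - int (hom F H')) * d = 1] (mod int p)"
    using mod_prime_inverse[OF p, of "int (hom F H) - int (hom F H')"] by (auto simp: cong_iff_dvd_diff)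
  \<comment> \<open>the product of \<open>xs\<close> with \<open>d (hom(F, -) - hom(F, H'))\<close>, which is 1 at \<open>H\<close> and 0 at \<open>H'\<close>\<close>
  let ?ys = "map (\<lambda>(c, G). (c * d, graph_sum F G)) xs @ map (\<lambda>(c, G). (- c * d * int (hom F H'), G)) xs"
  have *: "(\<Sum>(c, G) \<leftarrow> ?ys. c * int (hom G K)) =
      (\<Sum>(c, G) \<leftarrow> xs. c * int (hom G K)) * ((int (hom F K) - int (hom F H')) * d)" for K :: "'v graph"
    using xs(1) by (induction xs) (auto simp: hom_graph_sum[OF F(1)] algebra_simps)
  have "\<forall>(c, G) \<in> set ?ys. input_graph G"
    using xs(1) input_graph_graph_sum[OF F(1)] by auto
  moreover have "[(\<Sum>(c, G) \<leftarrow> ?ys. c * int (hom G H)) = 1] (mod int p)"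
    unfolding * using cong_mult[OF xs(2) d] by simp
  moreover have "[(\<Sum>(c, G) \<leftarrow> ?ys. c * int (hom G K)) = 0] (mod int p)" if "K \<in> insert H' J" for K
  proof (cases "K = H'")
    case True
    then show ?thesis unfolding * by simp
  next
    case False
    with that have "K \<in> J" by simp
    then show ?thesis unfolding * using cong_mult[OF xs(3) cong_refl] by fastforce
  qed
  ultimately show ?case by blast
qed

text \<open>The indicator combination removes every constituent but \<open>H\<close> from the
  answers; the inverse \<open>a\<close> of the coefficient of \<open>H\<close> cancels the remaining
  factor.\<close>

lemma reducible_Hom_QHom:
  fixes Hbar :: "'v graph \<Rightarrow>\<^sub>0 int"
  assumes p: "prime p" and Q: "quantum_graph Hbar"
    and coeff: "\<forall>H \<in> Poly_Mapping.keys Hbar. Poly_Mapping.lookup Hbar H \<in> {1..int p - 1}"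
    and red: "\<forall>H \<in> Poly_Mapping.keys Hbar. order_reduced p H"
    and H: "H \<in> Poly_Mapping.keys Hbar"
  shows "poly_turing_reducible (Hom_problem p H) (QHom_problem p Hbar)"
proof -
  let ?S = "Poly_Mapping.keys Hbar" and ?\<alpha> = "Poly_Mapping.lookup Hbar"
  have p0: "p > 0" using p by (simp add: prime_gt_0_nat)
  obtain xs where xs: "\<forall>(c, F) \<in> set xs. input_graph F"
    "[(\<Sum>(c, F) \<leftarrow> xs. c * int (hom F H)) = 1] (mod int p)"
    "\<forall>K \<in> ?S - {H}. [(\<Sum>(c, F) \<leftarrow> xs. c * int (hom F K)) = 0] (mod int p)"
  proof -
    have "is_graph K \<and> order_reduced p K \<and> \<not> isomorphic H K" if "K \<in> ?S - {H}" for K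
      using that Q red H by (auto simp: quantum_graph_def pairwise_def)
    then show thesis
      using indicator_combination[OF p, of "?S - {H}" H] that Q red H by (auto simp: quantum_graph_def)
  qed
  have "\<not> int p dvd ?\<alpha> H"
    using coeff H by (auto dest!: zdvd_imp_le)
  then obtain a where a: "[?\<alpha> H * a = 1] (mod int p)"
    using mod_prime_inverse[OF p] by blast
  let ?q = "\<lambda>F G. qhom (Poly_Mapping.single (graph_sum F G) 1) Hbar"
  let ?ys = "map (\<lambda>(c, F). (a * c, ?q F)) xs"
  have q: "?q F G = (\<Sum>K \<in> ?S. ?\<alpha> K * int (hom F K) * int (hom G K))"
    if "input_graph F" "input_graph G" for F G
    using that by (simp add: qhom_def hom_graph_sum mult.assoc)
  have "[(\<Sum>(c, f) \<leftarrow> ?ys. c * f G) = int (hom G H)] (mod int p)" if G: "input_graph G" for G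
  proof -
    let ?h = "\<lambda>K. \<Sum>(c, F) \<leftarrow> xs. c * int (hom F K)"
    have "(\<Sum>(c, f) \<leftarrow> ?ys. c * f G) = (\<Sum>K \<in> ?S. a * ?\<alpha> K * ?h K * int (hom G K))"
      using xs(1) by (induction xs) (auto simp: q[OF _ G] sum.distrib sum_distrib_left algebra_simps)
    also have "[\<dots> = (\<Sum>K \<in> ?S. a * ?\<alpha> K * of_bool (K = H) * int (hom G K))] (mod int p)"
      using xs(2,3) by (intro cong_sum cong_mult cong_refl) auto
    also have "(\<Sum>K \<in> ?S. a * ?\<alpha> K * of_bool (K = H) * int (hom G K)) = ?\<alpha> H * a * int (hom G H)"
      using H by (simp add: of_bool_def if_distrib if_distribR sum.delta mult.commute cong: if_cong)
    also have "[\<dots> = 1 * int (hom G H)] (mod int p)"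
      by (intro cong_mult a cong_refl)
    finally show ?thesis by simp
  qed
  then have "Hom_problem p H = graph_problem p (\<lambda>G. \<Sum>(c, f) \<leftarrow> ?ys. c * f G)"
    unfolding Hom_problem_eq by (intro graph_problem_cong) (rule cong_sym)
  moreover have "poly_turing_reducible \<dots> (QHom_problem p Hbar)"
    using xs(1) by (intro reducible_sum_list p0) (auto intro: reducible_graph_sum[OF p0])
  ultimately show ?thesis by simp
qed

theorem theorem1p1:
  fixes p :: nat and Hbar :: "'v graph \<Rightarrow>\<^sub>0 int"
  assumes "prime p"
    and "quantum_graph Hbar"
    and "\<forall>H \<in> Poly_Mapping.keys Hbar. Poly_Mapping.lookup Hbar H \<in> {1..int p - 1}"
    and "\<forall>H \<in> p_constituents p Hbar. order_reduced p H"
  shows "((\<exists>H \<in> p_constituents p Hbar. sharp_mod_P_hard p (Hom_problem p H))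
            \<longrightarrow> sharp_mod_P_hard p (QHom_problem p Hbar)) \<and>
         ((\<forall>H \<in> p_constituents p Hbar. poly_time_solvable (Hom_problem p H))
            \<longrightarrow> poly_time_solvable (QHom_problem p Hbar))"
proof -
  let ?S = "Poly_Mapping.keys Hbar" and ?\<alpha> = "Poly_Mapping.lookup Hbar"
  have p0: "p > 0" using assms(1) by (simp add: prime_gt_0_nat)
  \<comment> \<open>Coefficients between 1 and \<open>p - 1\<close> are nonzero modulo
    \<open>p\<close>, so the constituents are the whole support.\<close>
  have "\<not> int p dvd ?\<alpha> H" if "H \<in> ?S" for H
    using assms(3) that by (auto dest!: zdvd_imp_le)
  then have S: "p_constituents p Hbar = ?S" by (auto simp: p_constituents_def)
  have "sharp_mod_P_hard p (QHom_problem p Hbar)"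
    if "H \<in> ?S" "sharp_mod_P_hard p (Hom_problem p H)" for H
    using that poly_turing_reducible_trans reducible_Hom_QHom[OF assms(1-3) assms(4)[unfolded S]]
    unfolding sharp_mod_P_hard_def by blast
  moreover have "poly_time_solvable (QHom_problem p Hbar)"
    if "\<forall>H \<in> ?S. poly_time_solvable (Hom_problem p H)"
  proof -
    obtain Hs where Hs: "set Hs = ?S" "distinct Hs" using finite_distinct_list[of ?S] by auto
    let ?xs = "map (\<lambda>H. (?\<alpha> H, \<lambda>G. int (hom G H))) Hs"
    have "(\<lambda>G. \<Sum>(c, f) \<leftarrow> ?xs. c * f G) = (\<lambda>G. \<Sum>H \<in> ?S. ?\<alpha> H * int (hom G H))"
      by (simp add: fun_eq_iff comp_def sum_list_distinct_conv_sum_set Hs)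
    moreover have "poly_turing_reducible (graph_problem p (\<lambda>G. \<Sum>(c, f) \<leftarrow> ?xs. c * f G)) {}"
      using that Hs by (intro reducible_sum_list p0) (auto simp: poly_time_solvable_def Hom_problem_eq)
    ultimately have "poly_turing_reducible (graph_problem p (\<lambda>G. \<Sum>H \<in> ?S. ?\<alpha> H * int (hom G H))) {}"
      by (rule back_subst[where P = "\<lambda>f. poly_turing_reducible (graph_problem p f) {}", rotated])
    \<comment> \<open>The weighted sum is computable without an oracle, and transitivity substitutes
      this computation for the queries of \<open>reducible_quantum\<close>.\<close>
    then show ?thesis
      unfolding poly_time_solvable_def by (rule poly_turing_reducible_trans[OF reducible_quantum[OF p0]])
  qed
  ultimately show ?thesis unfolding S by blast
qed

end
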